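(* Let $k\geq 2$, $\alpha>1$, $0<\varepsilon<1$, and let $\mathcal{F}$ be a family of $k$-graphs with $\pi(\mathcal{F})>0$. For each $n$, let $\mathcal{G}_{n}$ be the collection of all $n$-vertex $\mathcal{F}$-free $k$-graphs with minimum degree at least $(1-\varepsilon)\pi(\mathcal{F})\binom{n}{k-1}$, and let $\lambda_{\alpha}(\mathcal{G}_{n})=\max\{\lambda_{\alpha}(G):G\in \mathcal{G}_{n}\}$. Put $\varepsilon'=\varepsilon\pi(\mathcal{F})(\alpha-1)/(2k\alpha)$. Suppose that there exists $N$ such that for all $n\geq N$, $$\lambda_{\alpha}(\mathcal{G}_{n}) \ge \lambda_{\alpha}(\mathcal{G}_{n-1}) + (k-k/\alpha)(1-\varepsilon')\pi(\mathcal{F})\,n^{k-k/\alpha-1}.$$ Then there exists $n_{0}$ such that if $H$ is an $\mathcal{F}$-free $k$-graph on $n\geq n_{0}$ vertices, then $\lambda_{\alpha}(H)\leq \lambda_{\alpha}(\mathcal{G}_{n})$. In addition, if equality holds, then $H\in\mathcal{G}_{n}$.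
   Context: A $k$-graph is a hypergraph all of whose edges have exactly $k$ vertices. A $k$-graph is $\mathcal{F}$-free if it contains no member of $\mathcal{F}$ as a sub-hypergraph. $\mathrm{ex}(n,\mathcal{F})$ is the maximum number of edges of an $\mathcal{F}$-free $k$-graph on $n$ vertices, and $\pi(\mathcal{F})=\lim_{n\to\infty}\mathrm{ex}(n,\mathcal{F})/\binom{n}{k}$ is the Turán density. For a $k$-graph $G$ on vertex set $V$ and $\alpha>1$, the Lagrangian polynomial is $P_G(\mathbf{x})=k!\sum_{\{i_1,\dots,i_k\}\in E(G)}x_{i_1}\cdots x_{i_k}$ for $\mathbf{x}\in\mathbb{R}^V$, and the $\alpha$-spectral radius is $\lambda_\alpha(G)=\max\{P_G(\mathbf{x}):\|\mathbf{x}\|_\alpha=1\}$, where $\|\mathbf{x}\|_\alpha=(\sum_i|x_i|^\alpha)^{1/\alpha}$. *)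

theory Defs
  imports Complex_Main "HOL-Library.Infinite_Typeclass"
begin

type_synonym 'a hypergraph = "'a set \<times> 'a set set"

abbreviation verts :: "'a hypergraph \<Rightarrow> 'a set" where "verts G \<equiv> fst G"
abbreviation edges :: "'a hypergraph \<Rightarrow> 'a set set" where "edges G \<equiv> snd G"

definition kgraph :: "nat \<Rightarrow> 'a hypergraph \<Rightarrow> bool" where
  "kgraph k G \<longleftrightarrow> finite (verts G) \<and> (\<forall>e\<in>edges G. e \<subseteq> verts G \<and> card e = k)"

text \<open>Containment as a (not necessarily induced) sub-hypergraph, up to isomorphism.\<close>

definition contains_copy :: "'a hypergraph \<Rightarrow> 'a hypergraph \<Rightarrow> bool" where
  "contains_copy G F \<longleftrightarrow>
     (\<exists>f. inj_on f (verts F) \<and> f ` verts F \<subseteq> verts G \<and> (\<forall>e\<in>edges F. f ` e \<in> edges G))"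

definition family_free :: "'a hypergraph set \<Rightarrow> 'a hypergraph \<Rightarrow> bool" where
  "family_free \<F> G \<longleftrightarrow> (\<forall>F\<in>\<F>. \<not> contains_copy G F)"

text \<open>The vertex type is infinite, so that it carries \<open>k\<close>-graphs of every finite order. If no
  \<open>n\<close>-vertex \<open>\<F>\<close>-free \<open>k\<close>-graph exists, the value is the unspecified constant \<open>Max {}\<close>; this happens
  for all large \<open>n\<close> or for none, and in the former case the Turan density below is \<open>0\<close>.\<close>

definition ex_num :: "nat \<Rightarrow> nat \<Rightarrow> 'a::infinite hypergraph set \<Rightarrow> nat" where
  "ex_num k n \<F> =
     Max {card (edges G) |G. kgraph k G \<and> card (verts G) = n \<and> family_free \<F> G}"

definition turan_density :: "nat \<Rightarrow> 'a::infinite hypergraph set \<Rightarrow> real" where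
  "turan_density k \<F> = lim (\<lambda>n. real (ex_num k n \<F>) / real (n choose k))"

definition degree :: "'a hypergraph \<Rightarrow> 'a \<Rightarrow> nat" where
  "degree G v = card {e \<in> edges G. v \<in> e}"

definition min_degree :: "'a hypergraph \<Rightarrow> nat" where
  "min_degree G = Min (degree G ` verts G)"

text \<open>Vectors in \<open>\<real>\<^sup>V\<close> are functions on the whole vertex type; neither the polynomial nor the norm
  depends on the values outside \<open>V\<close>.\<close>

definition lagrangian_poly :: "nat \<Rightarrow> 'a hypergraph \<Rightarrow> ('a \<Rightarrow> real) \<Rightarrow> real" where
  "lagrangian_poly k G x = fact k * (\<Sum>e\<in>edges G. \<Prod>i\<in>e. x i)"

definition alpha_norm :: "real \<Rightarrow> 'a set \<Rightarrow> ('a \<Rightarrow> real) \<Rightarrow> real" where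
  "alpha_norm \<alpha> V x = (\<Sum>i\<in>V. \<bar>x i\<bar> powr \<alpha>) powr (1 / \<alpha>)"

text \<open>For nonempty \<open>V\<close> the supremum is attained, by compactness of the unit sphere.\<close>

definition spectral_radius :: "nat \<Rightarrow> real \<Rightarrow> 'a hypergraph \<Rightarrow> real" where
  "spectral_radius k \<alpha> G = Sup {lagrangian_poly k G x |x. alpha_norm \<alpha> (verts G) x = 1}"

definition dense_free_graphs ::
    "nat \<Rightarrow> 'a::infinite hypergraph set \<Rightarrow> real \<Rightarrow> nat \<Rightarrow> 'a hypergraph set" where
  "dense_free_graphs k \<F> \<epsilon> n =
     {G. kgraph k G \<and> card (verts G) = n \<and> family_free \<F> G \<and>
         real (min_degree G) \<ge> (1 - \<epsilon>) * turan_density k \<F> * real (n choose (k - 1))}"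

text \<open>The values form a finite set, since the spectral radius is invariant under isomorphism.\<close>

definition max_spectral_radius :: "nat \<Rightarrow> real \<Rightarrow> 'a hypergraph set \<Rightarrow> real" where
  "max_spectral_radius k \<alpha> \<G> = Max (spectral_radius k \<alpha> ` \<G>)"

end

theory Submission
  imports "HOL-Analysis.Analysis" "HOL-Real_Asymp.Real_Asymp" Defs
begin

text \<open>
  Write \<open>\<pi>\<close> for the Turan density, \<open>s = k - k/\<alpha>\<close>, and let \<open>x\<close> be a nonnegative unit vector attaining
  \<open>\<lambda>\<^sub>\<alpha>(H)\<close> for an \<open>\<F>\<close>-free \<open>H\<close> on \<open>n\<close> vertices. If every \<open>x\<^sub>u\<^sup>\<alpha>\<close> is at least \<open>(1 - \<eta>)/n\<close>, then \<open>x\<close> is so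
  close to the constant vector that the Lagrange condition
  \<open>k \<lambda> x\<^sub>u\<^bsup>\<alpha>-1\<^esup> = \<partial>P/\<partial>x\<^sub>u\<close> at a vertex of minimum degree forces \<open>H\<close> to have large minimum degree.
  So if \<open>H\<close> is not in \<open>\<G>\<^sub>n\<close> but \<open>\<lambda>\<^sub>\<alpha>(H) \<ge> \<lambda>\<^sub>\<alpha>(\<G>\<^sub>n)\<close>, some vertex has \<open>x\<^sub>u\<^sup>\<alpha> < (1 - \<eta>)/n\<close>, and deleting
  it lowers the spectral radius by less than the assumed increment of \<open>\<lambda>\<^sub>\<alpha>(\<G>\<^sub>n)\<close>; here the estimate
  \<open>\<lambda>\<^sub>\<alpha>(H) \<le> (\<pi> + o(1)) n\<^sup>s\<close> enters. Iterating, the gap between the two radii grows without bound,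
  which is absurd once a fixed number of vertices is left.
\<close>

section \<open>Elementary symmetric sums\<close>

definition esym :: "('a \<Rightarrow> real) \<Rightarrow> 'a set \<Rightarrow> nat \<Rightarrow> real" where
  "esym z W j = (\<Sum>T | T \<subseteq> W \<and> card T = j. \<Prod>i\<in>T. z i)"

lemma esym_0 [simp]: "finite W \<Longrightarrow> esym z W 0 = 1"
proof -
  assume "finite W"
  then have "{T. T \<subseteq> W \<and> card T = 0} = {{}}"
    by (auto dest: finite_subset)
  then show ?thesis by (simp add: esym_def)
qed

lemma esym_const_one: "finite W \<Longrightarrow> esym (\<lambda>_. 1) W j = real (card W choose j)"
  by (simp add: esym_def n_subsets)

lemma esym_Suc:
  assumes "finite W"
  shows "real (Suc j) * esym z W (Suc j) = (\<Sum>i\<in>W. z i * esym z (W - {i}) j)"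
proof -
  let ?U = "{U. U \<subseteq> W \<and> card U = Suc j}"
  have finU: "finite ?U" using assms by simp
  have "(\<Sum>i\<in>W. z i * esym z (W - {i}) j) = (\<Sum>i\<in>W. \<Sum>U | U \<in> ?U \<and> i \<in> U. \<Prod>l\<in>U. z l)"
  proof (rule sum.cong[OF refl])
    fix i assume i: "i \<in> W"
    show "z i * esym z (W - {i}) j = (\<Sum>U | U \<in> ?U \<and> i \<in> U. \<Prod>l\<in>U. z l)"
      unfolding esym_def sum_distrib_left
    proof (rule sum.reindex_bij_witness[of _ "\<lambda>U. U - {i}" "insert i"])
      fix T assume T: "T \<in> {T. T \<subseteq> W - {i} \<and> card T = j}"
      then have f: "finite T" "i \<notin> T" using assms finite_subset by auto
      then show "insert i T - {i} = T" by auto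
      show "insert i T \<in> {U \<in> ?U. i \<in> U}" using T f i by auto
      show "prod z (insert i T) = z i * prod z T" using f by simp
    next
      fix U assume U: "U \<in> {U \<in> ?U. i \<in> U}"
      then show "insert i (U - {i}) = U" by auto
      show "U - {i} \<in> {T. T \<subseteq> W - {i} \<and> card T = j}"
        using U assms by (auto simp: card_Diff_singleton dest: finite_subset)
    qed
  qed
  also have "\<dots> = (\<Sum>U\<in>?U. \<Sum>i | i \<in> W \<and> i \<in> U. \<Prod>l\<in>U. z l)"
    using sum.swap_restrict[OF assms finU, of "\<lambda>_ U. \<Prod>l\<in>U. z l" "\<lambda>i U. i \<in> U"] by simp
  also have "\<dots> = (\<Sum>U\<in>?U. real (Suc j) * (\<Prod>l\<in>U. z l))"
  proof (rule sum.cong[OF refl])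
    fix U assume U: "U \<in> ?U"
    then have "{i. i \<in> W \<and> i \<in> U} = U" by auto
    then show "(\<Sum>i | i \<in> W \<and> i \<in> U. \<Prod>l\<in>U. z l) = real (Suc j) * (\<Prod>l\<in>U. z l)"
      using U by simp
  qed
  finally show ?thesis by (simp add: esym_def sum_distrib_left)
qed

lemma fact_esym_Suc:
  assumes "finite W"
  shows "fact (Suc j) * esym z W (Suc j) = (\<Sum>i\<in>W. z i * (fact j * esym z (W - {i}) j))"
proof -
  have "fact (Suc j) * esym z W (Suc j) = fact j * (real (Suc j) * esym z W (Suc j))"
    by (simp add: algebra_simps)
  then show ?thesis
    unfolding esym_Suc[OF assms] by (simp add: sum_distrib_left mult.left_commute)
qed

lemma esym_le_power_sum:
  assumes "finite W" and "\<And>i. i \<in> W \<Longrightarrow> 0 \<le> z i"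
  shows "fact j * esym z W j \<le> (\<Sum>i\<in>W. z i) ^ j"
  using assms
proof (induction j arbitrary: W)
  case 0
  then show ?case by simp
next
  case (Suc j)
  have "z i * (fact j * esym z (W - {i}) j) \<le> z i * (\<Sum>i\<in>W. z i) ^ j" if "i \<in> W" for i
  proof -
    have "fact j * esym z (W - {i}) j \<le> (\<Sum>i\<in>W - {i}. z i) ^ j"
      by (rule Suc.IH) (use Suc.prems in auto)
    also have "\<dots> \<le> (\<Sum>i\<in>W. z i) ^ j"
      by (intro power_mono sum_mono2 sum_nonneg) (use Suc.prems in auto)
    finally show ?thesis using Suc.prems that by (simp add: mult_left_mono)
  qed
  then have "fact (Suc j) * esym z W (Suc j) \<le> (\<Sum>i\<in>W. z i * (\<Sum>i\<in>W. z i) ^ j)"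
    unfolding fact_esym_Suc[OF \<open>finite W\<close>] by (rule sum_mono)
  then show ?case by (simp add: sum_distrib_right)
qed

lemma esym_ge_power_sum:
  assumes "finite W" and "\<And>i. i \<in> W \<Longrightarrow> 0 \<le> z i \<and> z i \<le> M"
    and "0 \<le> M" and "real j * M \<le> (\<Sum>i\<in>W. z i)"
  shows "((\<Sum>i\<in>W. z i) - real j * M) ^ j \<le> fact j * esym z W j"
  using assms
proof (induction j arbitrary: W)
  case 0
  then show ?case by simp
next
  case (Suc j)
  let ?s = "\<Sum>i\<in>W. z i"
  let ?a = "?s - real (Suc j) * M"
  have a: "0 \<le> ?a" "?a \<le> ?s" using Suc.prems by simp_all
  have "z i * ?a ^ j \<le> z i * (fact j * esym z (W - {i}) j)" if i: "i \<in> W" for i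
  proof -
    have s: "(\<Sum>l\<in>W - {i}. z l) = ?s - z i"
      using i Suc.prems(1) by (simp add: sum_diff1)
    have zi: "z i \<le> M" using Suc.prems i by auto
    then have le: "?a \<le> (?s - z i) - real j * M" by (simp add: algebra_simps)
    have "?a ^ j \<le> ((?s - z i) - real j * M) ^ j"
      by (rule power_mono[OF le a(1)])
    also have "\<dots> \<le> fact j * esym z (W - {i}) j"
      unfolding s[symmetric]
      by (rule Suc.IH) (use Suc.prems s le a(1) in auto)
    finally show ?thesis using Suc.prems i by (simp add: mult_left_mono)
  qed
  then have "(\<Sum>i\<in>W. z i * ?a ^ j) \<le> fact (Suc j) * esym z W (Suc j)"
    unfolding fact_esym_Suc[OF \<open>finite W\<close>] by (rule sum_mono)
  moreover have "?a ^ Suc j \<le> (\<Sum>i\<in>W. z i * ?a ^ j)"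
    unfolding sum_distrib_right[symmetric] power_Suc
    by (rule mult_right_mono) (use a in auto)
  ultimately show ?case by linarith
qed

lemma falling_power_ge:
  assumes "j \<le> n"
  shows "(real n - real j) ^ j \<le> fact j * real (n choose j)"
  using esym_ge_power_sum[of "{..<n}" "\<lambda>_. 1" 1 j] assms by (simp add: esym_const_one)

section \<open>Free hypergraphs and the Turan density\<close>

definition induced :: "'a hypergraph \<Rightarrow> 'a set \<Rightarrow> 'a hypergraph" where
  "induced G T = (T, {e \<in> edges G. e \<subseteq> T})"

lemma verts_induced [simp]: "verts (induced G T) = T"
  and edges_induced [simp]: "edges (induced G T) = {e \<in> edges G. e \<subseteq> T}"
  by (simp_all add: induced_def)

lemma kgraph_induced:
  assumes "kgraph k G" and "T \<subseteq> verts G"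
  shows "kgraph k (induced G T)"
  using assms by (auto simp: kgraph_def induced_def dest: finite_subset)

lemma family_free_induced:
  assumes "family_free \<F> G" and "T \<subseteq> verts G"
  shows "family_free \<F> (induced G T)"
proof -
  have "contains_copy G F" if copy: "contains_copy (induced G T) F" for F
  proof -
    obtain f where "inj_on f (verts F)" "f ` verts F \<subseteq> T" "\<forall>e\<in>edges F. f ` e \<in> edges G"
      using copy by (auto simp: contains_copy_def induced_def)
    then show ?thesis using assms(2) unfolding contains_copy_def by blast
  qed
  then show ?thesis using assms(1) by (auto simp: family_free_def)
qed

lemma finite_edges: "kgraph k G \<Longrightarrow> finite (edges G)"
  by (rule finite_subset[of _ "Pow (verts G)"]) (auto simp: kgraph_def)

lemma card_edges_le: "kgraph k G \<Longrightarrow> card (edges G) \<le> card (verts G) choose k"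
proof -
  assume G: "kgraph k G"
  then have "edges G \<subseteq> {T. T \<subseteq> verts G \<and> card T = k}" by (auto simp: kgraph_def)
  moreover have "finite (verts G)" using G by (simp add: kgraph_def)
  ultimately show ?thesis using card_mono[of "{T. T \<subseteq> verts G \<and> card T = k}"]
    by (simp add: n_subsets)
qed

lemma finite_edge_counts:
  "finite {card (edges G) |G. kgraph k G \<and> card (verts G) = n \<and> family_free \<F> G}"
  by (rule finite_subset[of _ "{..n choose k}"]) (auto dest: card_edges_le)

lemma card_edges_le_ex_num:
  assumes "kgraph k G" and "card (verts G) = n" and "family_free \<F> G"
  shows "card (edges G) \<le> ex_num k n \<F>"
  unfolding ex_num_def by (rule Max_ge[OF finite_edge_counts]) (use assms in blast)

lemma ex_num_attained:
  fixes G :: "'a::infinite hypergraph"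
  assumes "kgraph k G" and "card (verts G) = n" and "family_free \<F> G"
  obtains G' :: "'a hypergraph" where "kgraph k G'" "card (verts G') = n" "family_free \<F> G'"
    "card (edges G') = ex_num k n \<F>"
proof -
  let ?S = "{card (edges G) |G. kgraph k G \<and> card (verts G) = n \<and> family_free \<F> G}"
  have "?S \<noteq> {}" using assms by blast
  then have "ex_num k n \<F> \<in> ?S"
    unfolding ex_num_def by (rule Max_in[OF finite_edge_counts])
  then show ?thesis using that by auto
qed

text \<open>Sums over \<open>m\<close>-subsets \<open>T\<close>, weighted by \<open>\<Prod>i\<in>T. z i\<close>, the number of edges inside \<open>T\<close>. Weights
  \<open>z = 1\<close> yield the monotonicity of the extremal density; spread-out probability weights bound
  the Lagrangian polynomial by it.\<close>

lemma weighted_double_count: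
  fixes G :: "'a::infinite hypergraph"
  assumes G: "kgraph k G" "family_free \<F> G" and z: "\<And>i. i \<in> verts G \<Longrightarrow> 0 \<le> z i"
    and "k \<le> m"
  shows "(\<Sum>e\<in>edges G. (\<Prod>i\<in>e. z i) * esym z (verts G - e) (m - k))
           \<le> real (ex_num k m \<F>) * esym z (verts G) m"
proof -
  let ?V = "verts G" and ?E = "edges G"
  let ?T = "{T. T \<subseteq> ?V \<and> card T = m}"
  have finV: "finite ?V" using G by (simp add: kgraph_def)
  have finE: "finite ?E" using G finite_edges by blast
  have finT: "finite ?T" using finV by simp
  have "(\<Sum>e\<in>?E. (\<Prod>i\<in>e. z i) * esym z (?V - e) (m - k))
      = (\<Sum>e\<in>?E. \<Sum>T | T \<in> ?T \<and> e \<subseteq> T. \<Prod>i\<in>T. z i)"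
  proof (rule sum.cong[OF refl])
    fix e assume "e \<in> ?E"
    then have e: "e \<subseteq> ?V" "card e = k" "finite e"
      using G finV by (auto simp: kgraph_def intro: finite_subset)
    show "(\<Prod>i\<in>e. z i) * esym z (?V - e) (m - k) = (\<Sum>T | T \<in> ?T \<and> e \<subseteq> T. \<Prod>i\<in>T. z i)"
      unfolding esym_def sum_distrib_left
    proof (rule sum.reindex_bij_witness[of _ "\<lambda>U. U - e" "\<lambda>T. e \<union> T"])
      fix T assume T: "T \<in> {T. T \<subseteq> ?V - e \<and> card T = m - k}"
      then have f: "finite T" "e \<inter> T = {}" using finV finite_subset by auto
      then show "e \<union> T - e = T" by auto
      show "e \<union> T \<in> {U \<in> ?T. e \<subseteq> U}"
        using T f e \<open>k \<le> m\<close> by (auto simp: card_Un_disjoint)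
      show "prod z (e \<union> T) = prod z e * prod z T"
        using f e by (simp add: prod.union_disjoint)
    next
      fix U assume U: "U \<in> {U \<in> ?T. e \<subseteq> U}"
      then show "e \<union> (U - e) = U" by auto
      show "U - e \<in> {T. T \<subseteq> ?V - e \<and> card T = m - k}"
        using U e by (auto simp: card_Diff_subset)
    qed
  qed
  also have "\<dots> = (\<Sum>T\<in>?T. \<Sum>e | e \<in> ?E \<and> e \<subseteq> T. \<Prod>i\<in>T. z i)"
    using sum.swap_restrict[OF finE finT, of "\<lambda>_ T. \<Prod>i\<in>T. z i" "\<lambda>e T. e \<subseteq> T"] by simp
  also have "\<dots> \<le> (\<Sum>T\<in>?T. real (ex_num k m \<F>) * (\<Prod>i\<in>T. z i))"
  proof (rule sum_mono)
    fix T assume T: "T \<in> ?T"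
    have "card (edges (induced G T)) \<le> ex_num k m \<F>"
      by (rule card_edges_le_ex_num)
         (use T G in \<open>auto simp: kgraph_induced family_free_induced\<close>)
    moreover have "0 \<le> (\<Prod>i\<in>T. z i)" by (rule prod_nonneg) (use T z in auto)
    ultimately show "(\<Sum>e | e \<in> ?E \<and> e \<subseteq> T. \<Prod>i\<in>T. z i) \<le> real (ex_num k m \<F>) * (\<Prod>i\<in>T. z i)"
      by (simp add: induced_def mult_right_mono)
  qed
  finally show ?thesis by (simp add: esym_def sum_distrib_left)
qed

definition edge_density :: "nat \<Rightarrow> 'a::infinite hypergraph set \<Rightarrow> nat \<Rightarrow> real" where
  "edge_density k \<F> n = real (ex_num k n \<F>) / real (n choose k)"

lemma edge_density_antimono:
  fixes G :: "'a::infinite hypergraph"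
  assumes "kgraph k G" "card (verts G) = n" "family_free \<F> G" and "k \<le> m" "m \<le> n"
  shows "edge_density k \<F> n \<le> edge_density k \<F> m"
proof -
  obtain G' :: "'a hypergraph" where G': "kgraph k G'" "card (verts G') = n" "family_free \<F> G'"
    "card (edges G') = ex_num k n \<F>"
    using ex_num_attained[OF assms(1-3)] .
  have fin: "finite (verts G')" using G' by (simp add: kgraph_def)
  have "real (card (verts G' - e) choose (m - k)) = real ((n - k) choose (m - k))"
    if "e \<in> edges G'" for e
    using that G' fin by (auto simp: kgraph_def card_Diff_subset finite_subset)
  then have "real (ex_num k n \<F>) * real ((n - k) choose (m - k))
      \<le> real (ex_num k m \<F>) * real (n choose m)"
    using weighted_double_count[OF G'(1,3), of "\<lambda>_. 1" m] fin \<open>k \<le> m\<close> G'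
    by (simp add: esym_const_one)
  moreover have "real (n choose m) * real (m choose k) = real (n choose k) * real ((n - k) choose (m - k))"
    using choose_mult[OF \<open>k \<le> m\<close> \<open>m \<le> n\<close>] by (metis of_nat_mult)
  moreover have "real (n choose k) > 0" "real (m choose k) > 0" "real ((n - k) choose (m - k)) > 0"
    using assms by simp_all
  ultimately have "real (ex_num k n \<F>) * real ((n - k) choose (m - k)) * real (m choose k)
      \<le> real (ex_num k m \<F>) * real (n choose k) * real ((n - k) choose (m - k))"
    by (metis (no_types, lifting) mult.assoc mult_right_mono of_nat_0_le_iff)
  then have "real (ex_num k n \<F>) * real (m choose k) \<le> real (ex_num k m \<F>) * real (n choose k)"
    using \<open>real ((n - k) choose (m - k)) > 0\<close>
    by (simp add: mult.commute mult.left_commute)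
  then show ?thesis
    using \<open>real (n choose k) > 0\<close> \<open>real (m choose k) > 0\<close>
    unfolding edge_density_def by (simp add: field_simps)
qed

lemma choose_filterlim_at_top:
  assumes "1 \<le> k"
  shows "filterlim (\<lambda>n. real (n choose k)) at_top sequentially"
proof (rule filterlim_at_top_mono)
  show "filterlim (\<lambda>n. real n - real k) at_top sequentially" by real_asymp
  show "\<forall>\<^sub>F n in sequentially. real n - real k \<le> real (n choose k)"
  proof (rule eventually_sequentiallyI)
    fix n assume "n \<ge> k"
    then show "real n - real k \<le> real (n choose k)"
    proof (induction n rule: dec_induct)
      case (step n)
      obtain l where l: "k = Suc l" using assms by (cases k) auto
      have "n choose l \<ge> 1" using step l by (simp add: Suc_leI)
      then show ?case using step by (simp add: l)
    qed simp
  qed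
qed

lemma exists_free_graph:
  fixes \<F> :: "'a::infinite hypergraph set"
  assumes "1 \<le> k" and "turan_density k \<F> \<noteq> 0"
  shows "\<exists>G :: 'a hypergraph. kgraph k G \<and> card (verts G) = n \<and> family_free \<F> G"
proof (rule ccontr)
  assume no: "\<not> ?thesis"
  let ?S = "\<lambda>m. {card (edges G) |G :: 'a hypergraph. kgraph k G \<and> card (verts G) = m \<and> family_free \<F> G}"
  have "?S m = {}" if mn: "m \<ge> n" for m
  proof (rule ccontr)
    assume "?S m \<noteq> {}"
    then obtain G :: "'a hypergraph" where G: "kgraph k G" "card (verts G) = m" "family_free \<F> G"
      by blast
    obtain T where T: "T \<subseteq> verts G" "card T = n"
      using obtain_subset_with_card_n[of n "verts G"] G mn by auto
    then have "kgraph k (induced G T) \<and> card (verts (induced G T)) = n \<and> family_free \<F> (induced G T)"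
      using G by (simp add: kgraph_induced family_free_induced)
    with no show False by blast
  qed
  then have "ex_num k m \<F> = Max {}" if "m \<ge> n" for m
    using that by (simp only: ex_num_def)
  then have "\<forall>\<^sub>F m in sequentially. real (Max {} :: nat) / real (m choose k)
      = real (ex_num k m \<F>) / real (m choose k)"
    by (intro eventually_sequentiallyI[of n]) simp
  moreover have "(\<lambda>m. real (Max {} :: nat) / real (m choose k)) \<longlonglongrightarrow> 0"
    by (rule real_tendsto_divide_at_top[OF tendsto_const choose_filterlim_at_top[OF assms(1)]])
  ultimately have "(\<lambda>m. real (ex_num k m \<F>) / real (m choose k)) \<longlonglongrightarrow> 0"
    using Lim_transform_eventually by fast
  then have "turan_density k \<F> = 0" unfolding turan_density_def by (rule limI)
  with assms show False by simp
qed

lemma edge_density_tendsto: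
  fixes \<F> :: "'a::infinite hypergraph set"
  assumes "1 \<le> k" and "turan_density k \<F> \<noteq> 0"
  shows "edge_density k \<F> \<longlonglongrightarrow> turan_density k \<F>"
proof -
  have "decseq (\<lambda>n. edge_density k \<F> (n + k))"
  proof (rule decseq_SucI)
    fix n
    show "edge_density k \<F> (Suc n + k) \<le> edge_density k \<F> (n + k)"
      using exists_free_graph[OF assms, of "Suc n + k"]
      by (auto intro: edge_density_antimono)
  qed
  moreover have "\<And>n. 0 \<le> edge_density k \<F> (n + k)" by (simp add: edge_density_def)
  ultimately obtain L where "(\<lambda>n. edge_density k \<F> (n + k)) \<longlonglongrightarrow> L"
    using decseq_convergent[of "\<lambda>n. edge_density k \<F> (n + k)" 0] by metis
  then have L: "edge_density k \<F> \<longlonglongrightarrow> L" by (rule LIMSEQ_offset)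
  moreover from L have "turan_density k \<F> = L"
    unfolding turan_density_def edge_density_def by (rule limI)
  ultimately show ?thesis by simp
qed

lemma turan_density_le_1:
  fixes \<F> :: "'a::infinite hypergraph set"
  assumes "1 \<le> k" and "turan_density k \<F> \<noteq> 0"
  shows "turan_density k \<F> \<le> 1"
proof (rule LIMSEQ_le_const2[OF edge_density_tendsto[OF assms]], intro exI allI impI)
  fix n :: nat
  obtain G :: "'a hypergraph" where G: "kgraph k G" "card (verts G) = n" "family_free \<F> G"
    using exists_free_graph[OF assms] by blast
  obtain G' :: "'a hypergraph" where G': "kgraph k G'" "card (verts G') = n"
    "card (edges G') = ex_num k n \<F>"
    using ex_num_attained[OF G] .
  have "ex_num k n \<F> \<le> n choose k" using card_edges_le[OF G'(1)] G' by simp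
  then show "edge_density k \<F> n \<le> 1" by (simp add: edge_density_def divide_le_eq)
qed

lemma lagrangian_poly_le_edge_density:
  fixes G :: "'a::infinite hypergraph"
  assumes G: "kgraph k G" "family_free \<F> G"
    and z: "\<And>i. i \<in> verts G \<Longrightarrow> 0 \<le> z i \<and> z i \<le> M" and sum1: "(\<Sum>i\<in>verts G. z i) = 1"
    and M: "0 \<le> M" "real m * M \<le> 1" and "k \<le> m"
  shows "lagrangian_poly k G z * (1 - real m * M) ^ m \<le> edge_density k \<F> m"
proof -
  let ?V = "verts G" and ?c = "(1 - real m * M) ^ m"
  have finV: "finite ?V" using G by (simp add: kgraph_def)
  have c: "?c \<le> fact (m - k) * esym z (?V - e) (m - k)" if "e \<in> edges G" for e
  proof -
    have e: "e \<subseteq> ?V" "card e = k" using that G by (auto simp: kgraph_def)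
    have "(\<Sum>i\<in>e. z i) \<le> real k * M"
      using sum_bounded_above[of e z M] e z by auto
    moreover have "(\<Sum>i\<in>?V - e. z i) = 1 - (\<Sum>i\<in>e. z i)"
      using sum_diff[OF finV e(1)] sum1 by metis
    ultimately have s: "1 - real m * M \<le> (\<Sum>i\<in>?V - e. z i) - real (m - k) * M"
      using \<open>k \<le> m\<close> by (simp add: of_nat_diff algebra_simps)
    have "?c \<le> (1 - real m * M) ^ (m - k)"
      by (rule power_decreasing) (use M in auto)
    also have "\<dots> \<le> ((\<Sum>i\<in>?V - e. z i) - real (m - k) * M) ^ (m - k)"
      by (rule power_mono[OF s]) (use M in auto)
    also have "\<dots> \<le> fact (m - k) * esym z (?V - e) (m - k)"
      by (rule esym_ge_power_sum) (use finV z M s in auto)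
    finally show ?thesis .
  qed
  have "(\<Sum>e\<in>edges G. \<Prod>i\<in>e. z i) * ?c
      \<le> (\<Sum>e\<in>edges G. (\<Prod>i\<in>e. z i) * (fact (m - k) * esym z (?V - e) (m - k)))"
    unfolding sum_distrib_right
    by (intro sum_mono mult_left_mono c prod_nonneg) (use G z in \<open>auto simp: kgraph_def\<close>)
  also have "\<dots> = fact (m - k) * (\<Sum>e\<in>edges G. (\<Prod>i\<in>e. z i) * esym z (?V - e) (m - k))"
    by (simp add: sum_distrib_left mult_ac)
  also have "\<dots> \<le> fact (m - k) * (real (ex_num k m \<F>) * esym z ?V m)"
    by (intro mult_left_mono weighted_double_count) (use G z \<open>k \<le> m\<close> in auto)
  also have "\<dots> \<le> fact (m - k) * (real (ex_num k m \<F>) * (1 / fact m))"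
    using esym_le_power_sum[OF finV, of z m] z sum1
    by (intro mult_left_mono) (auto simp: field_simps)
  finally have "fact k * ((\<Sum>e\<in>edges G. \<Prod>i\<in>e. z i) * ?c)
      \<le> fact k * (fact (m - k) * (real (ex_num k m \<F>) * (1 / fact m)))"
    by (rule mult_left_mono) simp
  then have "lagrangian_poly k G z * ?c \<le> fact k * (fact (m - k) * (real (ex_num k m \<F>) * (1 / fact m)))"
    unfolding lagrangian_poly_def by (simp only: mult.assoc)
  also have "\<dots> = edge_density k \<F> m"
    using binomial_fact[OF \<open>k \<le> m\<close>, where ?'a = real] by (simp add: edge_density_def)
  finally show ?thesis .
qed

section \<open>The spectral radius\<close>

definition link_sum :: "'a hypergraph \<Rightarrow> 'a \<Rightarrow> ('a \<Rightarrow> real) \<Rightarrow> real" where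
  "link_sum G u x = (\<Sum>e | e \<in> edges G \<and> u \<in> e. \<Prod>i\<in>e - {u}. x i)"

lemma lagrangian_poly_cong:
  assumes "kgraph k G" and "\<And>i. i \<in> verts G \<Longrightarrow> x i = y i"
  shows "lagrangian_poly k G x = lagrangian_poly k G y"
  unfolding lagrangian_poly_def using assms
  by (intro arg_cong2[where f = "(*)"] sum.cong prod.cong) (auto simp: kgraph_def)

lemma lagrangian_poly_scale:
  assumes "kgraph k G"
  shows "lagrangian_poly k G (\<lambda>i. c * x i) = c ^ k * lagrangian_poly k G x"
  using assms by (simp add: lagrangian_poly_def prod.distrib kgraph_def sum_distrib_left mult_ac)

lemma lagrangian_poly_nonneg:
  assumes "kgraph k G" and "\<And>i. i \<in> verts G \<Longrightarrow> 0 \<le> x i"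
  shows "0 \<le> lagrangian_poly k G x"
  unfolding lagrangian_poly_def using assms
  by (intro mult_nonneg_nonneg sum_nonneg prod_nonneg) (auto simp: kgraph_def)

lemma lagrangian_poly_le_abs:
  "lagrangian_poly k G x \<le> lagrangian_poly k G (\<lambda>i. \<bar>x i\<bar>)"
  unfolding lagrangian_poly_def
  by (intro mult_left_mono sum_mono) (simp_all add: abs_prod[symmetric])

lemma lagrangian_poly_le_power_sum:
  assumes G: "kgraph k G" and x: "\<And>i. i \<in> verts G \<Longrightarrow> 0 \<le> x i"
  shows "lagrangian_poly k G x \<le> (\<Sum>i\<in>verts G. x i) ^ k"
proof -
  have fin: "finite (verts G)" using G by (simp add: kgraph_def)
  have "(\<Sum>e\<in>edges G. \<Prod>i\<in>e. x i) \<le> esym x (verts G) k"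
    unfolding esym_def
    by (rule sum_mono2) (use G fin x in \<open>auto simp: kgraph_def intro: prod_nonneg\<close>)
  then have "lagrangian_poly k G x \<le> fact k * esym x (verts G) k"
    unfolding lagrangian_poly_def by (rule mult_left_mono) simp
  also have "\<dots> \<le> (\<Sum>i\<in>verts G. x i) ^ k"
    by (rule esym_le_power_sum) (use fin x in auto)
  finally show ?thesis .
qed

lemma lagrangian_poly_update:
  assumes G: "kgraph k G"
  shows "lagrangian_poly k G (x(u := t)) =
    lagrangian_poly k (induced G (verts G - {u})) x + t * (fact k * link_sum G u x)"
proof -
  have finE: "finite (edges G)" using finite_edges[OF G] .
  have e: "finite e" "e \<subseteq> verts G" if "e \<in> edges G" for e
    using G that by (auto simp: kgraph_def intro: finite_subset)
  have split: "edges G = {e \<in> edges G. e \<subseteq> verts G - {u}} \<union> {e \<in> edges G. u \<in> e}"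
    using e by auto
  have "(\<Sum>e\<in>edges G. \<Prod>i\<in>e. (x(u := t)) i) =
     (\<Sum>e | e \<in> edges G \<and> e \<subseteq> verts G - {u}. \<Prod>i\<in>e. (x(u := t)) i)
     + (\<Sum>e | e \<in> edges G \<and> u \<in> e. \<Prod>i\<in>e. (x(u := t)) i)"
    by (subst split, rule sum.union_disjoint) (use finE in auto)
  also have "(\<Sum>e | e \<in> edges G \<and> e \<subseteq> verts G - {u}. \<Prod>i\<in>e. (x(u := t)) i)
      = (\<Sum>e | e \<in> edges G \<and> e \<subseteq> verts G - {u}. \<Prod>i\<in>e. x i)"
    by (intro sum.cong prod.cong) auto
  also have "(\<Sum>e | e \<in> edges G \<and> u \<in> e. \<Prod>i\<in>e. (x(u := t)) i)
      = (\<Sum>e | e \<in> edges G \<and> u \<in> e. t * (\<Prod>i\<in>e - {u}. x i))"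
  proof (rule sum.cong[OF refl])
    fix d assume d: "d \<in> {e \<in> edges G. u \<in> e}"
    then have "(\<Prod>i\<in>d. (x(u := t)) i) = t * (\<Prod>i\<in>d - {u}. (x(u := t)) i)"
      using e[of d] prod.remove[of d u "x(u := t)"] by simp
    also have "(\<Prod>i\<in>d - {u}. (x(u := t)) i) = (\<Prod>i\<in>d - {u}. x i)"
      by (rule prod.cong) auto
    finally show "(\<Prod>i\<in>d. (x(u := t)) i) = t * (\<Prod>i\<in>d - {u}. x i)" .
  qed
  finally show ?thesis
    by (simp add: lagrangian_poly_def link_sum_def sum_distrib_left algebra_simps)
qed

lemma alpha_norm_eq_1_iff:
  assumes "\<alpha> > 0"
  shows "alpha_norm \<alpha> V x = 1 \<longleftrightarrow> (\<Sum>i\<in>V. \<bar>x i\<bar> powr \<alpha>) = 1"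
proof
  let ?s = "\<Sum>i\<in>V. \<bar>x i\<bar> powr \<alpha>"
  assume "alpha_norm \<alpha> V x = 1"
  then have "(?s powr (1 / \<alpha>)) powr \<alpha> = 1" by (simp add: alpha_norm_def)
  moreover have "0 \<le> ?s" by (simp add: sum_nonneg)
  ultimately show "?s = 1" using assms by (simp add: powr_powr)
qed (simp add: alpha_norm_def)

lemma spectral_radius_maximizer:
  fixes G :: "'a hypergraph"
  assumes G: "kgraph k G" "verts G \<noteq> {}" and \<alpha>: "\<alpha> > 0"
  obtains x where "\<And>i. 0 \<le> x i" "(\<Sum>i\<in>verts G. x i powr \<alpha>) = 1"
    "lagrangian_poly k G x = spectral_radius k \<alpha> G"
    "\<And>y. (\<Sum>i\<in>verts G. \<bar>y i\<bar> powr \<alpha>) = 1 \<Longrightarrow> lagrangian_poly k G y \<le> spectral_radius k \<alpha> G"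
proof -
  let ?V = "verts G"
  have fin: "finite ?V" using G by (simp add: kgraph_def)
  define C :: "('a \<Rightarrow> real) set" where "C = PiE UNIV (\<lambda>i. if i \<in> ?V then {0..1} else {0})"
  define K where "K = C \<inter> {x. (\<Sum>i\<in>?V. \<bar>x i\<bar> powr \<alpha>) = 1}"
  have coord: "continuous_on UNIV (\<lambda>x::'a \<Rightarrow> real. x i)" for i
    by (rule continuous_on_product_coordinates)
  have "compact C"
    unfolding C_def compactin_euclidean_iff[symmetric] euclidean_product_topology[symmetric]
    by (auto simp: compactin_PiE)
  moreover have "closed {x :: 'a \<Rightarrow> real. (\<Sum>i\<in>?V. \<bar>x i\<bar> powr \<alpha>) = 1}"
    by (intro closed_Collect_eq continuous_intros continuous_on_powr' coord) (use \<alpha> in auto)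
  ultimately have "compact K" unfolding K_def by (rule compact_Int_closed)
  obtain v where v: "v \<in> ?V" using G by blast
  have "(\<lambda>i. if i = v then 1 else 0) \<in> K"
  proof -
    have "(\<Sum>i\<in>?V. \<bar>if i = v then 1 else 0 :: real\<bar> powr \<alpha>) = (\<Sum>i\<in>?V. if i = v then 1 else 0)"
      by (rule sum.cong) auto
    also have "\<dots> = 1" using v fin by simp
    finally show ?thesis using v unfolding K_def C_def by auto
  qed
  then have "K \<noteq> {}" by blast
  have "continuous_on K (lagrangian_poly k G)"
    unfolding lagrangian_poly_def
    by (rule continuous_on_subset[of UNIV]) (intro continuous_intros coord, simp)
  then obtain x where x: "x \<in> K" and max: "\<And>y. y \<in> K \<Longrightarrow> lagrangian_poly k G y \<le> lagrangian_poly k G x"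
    using continuous_attains_sup[OF \<open>compact K\<close> \<open>K \<noteq> {}\<close>] by blast
  have x0: "0 \<le> x i" for i
  proof -
    have "x i \<in> (if i \<in> ?V then {0..1} else {0})"
      using x unfolding K_def C_def by (intro PiE_mem[of x UNIV]) simp_all
    then show ?thesis by (cases "i \<in> ?V") auto
  qed
  then have x1: "(\<Sum>i\<in>?V. x i powr \<alpha>) = 1" "(\<Sum>i\<in>?V. \<bar>x i\<bar> powr \<alpha>) = 1"
    using x unfolding K_def by auto
  have le: "lagrangian_poly k G y \<le> lagrangian_poly k G x"
    if y: "(\<Sum>i\<in>?V. \<bar>y i\<bar> powr \<alpha>) = 1" for y
  proof -
    define y' where "y' = (\<lambda>i. if i \<in> ?V then \<bar>y i\<bar> else 0)"
    have "\<bar>y i\<bar> \<le> 1" if "i \<in> ?V" for i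
    proof -
      have "\<bar>y i\<bar> powr \<alpha> \<le> 1"
        using member_le_sum[OF that, of "\<lambda>i. \<bar>y i\<bar> powr \<alpha>"] fin y by simp
      then show ?thesis using \<alpha> powr_less_mono2[of \<alpha> 1 "\<bar>y i\<bar>"] by fastforce
    qed
    moreover have "(\<Sum>i\<in>?V. \<bar>y' i\<bar> powr \<alpha>) = 1"
      using y unfolding y'_def by simp
    ultimately have "y' \<in> K" unfolding K_def C_def by (auto simp: y'_def)
    have "lagrangian_poly k G y \<le> lagrangian_poly k G (\<lambda>i. \<bar>y i\<bar>)"
      by (rule lagrangian_poly_le_abs)
    also have "\<dots> = lagrangian_poly k G y'"
      by (rule lagrangian_poly_cong[OF G(1)]) (simp add: y'_def)
    also have "\<dots> \<le> lagrangian_poly k G x" by (rule max[OF \<open>y' \<in> K\<close>])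
    finally show ?thesis .
  qed
  have "spectral_radius k \<alpha> G = lagrangian_poly k G x"
    unfolding spectral_radius_def alpha_norm_eq_1_iff[OF \<alpha>]
    by (rule cSup_eq_maximum) (use x1 le in auto)
  then show ?thesis by (intro that[of x]) (use x0 x1 le in simp_all)
qed

lemma spectral_radius_attained:
  assumes "kgraph k G" "verts G \<noteq> {}" and "\<alpha> > 0"
  obtains x where "\<And>i. 0 \<le> x i" "(\<Sum>i\<in>verts G. x i powr \<alpha>) = 1"
    "lagrangian_poly k G x = spectral_radius k \<alpha> G"
  by (rule spectral_radius_maximizer[OF assms], rule that)

lemma lagrangian_poly_le_spectral_radius:
  assumes G: "kgraph k G" "verts G \<noteq> {}" and \<alpha>: "\<alpha> > 0"
    and A: "A = (\<Sum>i\<in>verts G. \<bar>y i\<bar> powr \<alpha>)" "A > 0"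
  shows "lagrangian_poly k G y \<le> spectral_radius k \<alpha> G * A powr (real k / \<alpha>)"
proof -
  define c where "c = A powr (1 / \<alpha>)"
  have c: "c > 0" "c powr \<alpha> = A" using A \<alpha> by (simp_all add: c_def powr_powr)
  have ck: "c ^ k = A powr (real k / \<alpha>)"
    using A c by (simp add: c_def powr_realpow[symmetric] powr_powr)
  have "(\<Sum>i\<in>verts G. \<bar>(1 / c) * y i\<bar> powr \<alpha>) = (\<Sum>i\<in>verts G. \<bar>y i\<bar> powr \<alpha> / A)"
    using c by (intro sum.cong refl) (simp add: abs_mult powr_divide c(2)[symmetric])
  also have "\<dots> = 1" using A by (simp add: sum_divide_distrib[symmetric])
  finally have y1: "(\<Sum>i\<in>verts G. \<bar>(1 / c) * y i\<bar> powr \<alpha>) = 1" .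
  have "lagrangian_poly k G (\<lambda>i. (1 / c) * y i) \<le> spectral_radius k \<alpha> G"
  proof (rule spectral_radius_maximizer[OF G \<alpha>])
    assume le: "\<And>y. (\<Sum>i\<in>verts G. \<bar>y i\<bar> powr \<alpha>) = 1 \<Longrightarrow> lagrangian_poly k G y \<le> spectral_radius k \<alpha> G"
    show ?thesis by (rule le[OF y1])
  qed
  then have "lagrangian_poly k G y / c ^ k \<le> spectral_radius k \<alpha> G"
    unfolding lagrangian_poly_scale[OF G(1)] by (simp add: power_divide)
  then show ?thesis using c(1) by (simp add: ck[symmetric] field_simps)
qed

lemma spectral_radius_nonneg:
  assumes "kgraph k G" "verts G \<noteq> {}" and "\<alpha> > 0"
  shows "0 \<le> spectral_radius k \<alpha> G"
proof -
  obtain x where "\<And>i. 0 \<le> x i" "(\<Sum>i\<in>verts G. x i powr \<alpha>) = 1"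
    "lagrangian_poly k G x = spectral_radius k \<alpha> G"
    by (rule spectral_radius_attained[OF assms], rule that)
  then show ?thesis using lagrangian_poly_nonneg[OF assms(1), of x] by simp
qed

lemma stationary:
  assumes G: "kgraph k G" "verts G \<noteq> {}" and \<alpha>: "\<alpha> > 0"
    and x: "\<And>i. 0 \<le> x i" "(\<Sum>i\<in>verts G. x i powr \<alpha>) = 1"
      "lagrangian_poly k G x = spectral_radius k \<alpha> G"
    and u: "u \<in> verts G" "x u > 0"
  shows "fact k * link_sum G u x = real k * spectral_radius k \<alpha> G * x u powr (\<alpha> - 1)"
proof -
  let ?l = "spectral_radius k \<alpha> G" and ?B = "fact k * link_sum G u x"
  let ?P = "lagrangian_poly k (induced G (verts G - {u})) x"
  have fin: "finite (verts G)" using G by (simp add: kgraph_def)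
  define h where "h = (\<lambda>t. ?l * ((1 - x u powr \<alpha>) + t powr \<alpha>) powr (real k / \<alpha>) - (?P + t * ?B))"
  have rest: "(\<Sum>i\<in>verts G - {u}. x i powr \<alpha>) = 1 - x u powr \<alpha>"
    using u fin x by (simp add: sum_diff1)
  have h_nonneg: "0 \<le> h t" if "t > 0" for t
  proof -
    have "(\<Sum>i\<in>verts G. \<bar>(x(u := t)) i\<bar> powr \<alpha>)
        = t powr \<alpha> + (\<Sum>i\<in>verts G - {u}. \<bar>(x(u := t)) i\<bar> powr \<alpha>)"
      using u fin that by (simp add: sum.remove)
    also have "(\<Sum>i\<in>verts G - {u}. \<bar>(x(u := t)) i\<bar> powr \<alpha>) = (\<Sum>i\<in>verts G - {u}. x i powr \<alpha>)"
      using x by (intro sum.cong) auto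
    finally have A: "(1 - x u powr \<alpha>) + t powr \<alpha> = (\<Sum>i\<in>verts G. \<bar>(x(u := t)) i\<bar> powr \<alpha>)"
      using rest by simp
    have "0 \<le> 1 - x u powr \<alpha>" unfolding rest[symmetric] by (simp add: sum_nonneg)
    then have "0 < (1 - x u powr \<alpha>) + t powr \<alpha>" using that by (simp add: add_nonneg_pos)
    from lagrangian_poly_le_spectral_radius[OF G \<alpha> A this]
    show ?thesis unfolding h_def lagrangian_poly_update[OF G(1)] by simp
  qed
  have "h (x u) = 0"
    using lagrangian_poly_update[OF G(1), of x u "x u"] x by (simp add: h_def)
  then have min: "\<forall>y. \<bar>x u - y\<bar> < x u \<longrightarrow> h (x u) \<le> h y"
    using h_nonneg by auto
  have "(h has_real_derivative (?l * (real k / \<alpha> * (\<alpha> * x u powr (\<alpha> - 1))) - ?B)) (at (x u))"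
    unfolding h_def using u \<alpha> by (auto intro!: derivative_eq_intros)
  from DERIV_local_min[OF this u(2) min] show ?thesis using \<alpha> by (simp add: mult_ac)
qed

lemma spectral_radius_delete_vertex:
  assumes G: "kgraph k G" and V: "verts G - {u} \<noteq> {}" and \<alpha>: "\<alpha> > 0"
    and x: "\<And>i. 0 \<le> x i" "(\<Sum>i\<in>verts G. x i powr \<alpha>) = 1"
      "lagrangian_poly k G x = spectral_radius k \<alpha> G"
    and u: "u \<in> verts G" and t: "t = x u powr \<alpha>" "t < 1" "real k * t \<le> 1"
  shows "spectral_radius k \<alpha> G * ((1 - real k * t) * (1 + real k / \<alpha> * t))
           \<le> spectral_radius k \<alpha> (induced G (verts G - {u}))"
proof -
  let ?l = "spectral_radius k \<alpha> G" and ?G = "induced G (verts G - {u})"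
  have fin: "finite (verts G)" using G by (simp add: kgraph_def)
  have V': "verts G \<noteq> {}" using V by blast
  have l0: "0 \<le> ?l" by (rule spectral_radius_nonneg[OF G V' \<alpha>])
  have t0: "0 \<le> t" using t by simp
  have "x u * (fact k * link_sum G u x) = real k * ?l * t"
  proof (cases "x u = 0")
    case False
    then have xu: "x u > 0" using x(1)[of u] by simp
    have "x u * x u powr (\<alpha> - 1) = t"
      using xu t by (simp add: powr_diff)
    then show ?thesis
      unfolding stationary[OF G V' \<alpha> x u xu] by simp
  qed (use t \<alpha> in simp)
  then have P: "lagrangian_poly k ?G x = ?l * (1 - real k * t)"
    using lagrangian_poly_update[OF G, of x u "x u"] x by (simp add: algebra_simps)
  have A: "1 - t = (\<Sum>i\<in>verts ?G. \<bar>x i\<bar> powr \<alpha>)" "1 - t > 0"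
    using u fin x t by (simp_all add: sum_diff1)
  have "kgraph k ?G" by (rule kgraph_induced[OF G]) auto
  then have le: "?l * (1 - real k * t) \<le> spectral_radius k \<alpha> ?G * (1 - t) powr (real k / \<alpha>)"
    unfolding P[symmetric] using lagrangian_poly_le_spectral_radius[OF _ _ \<alpha> A] V by simp
  have "1 + real k / \<alpha> * t \<le> exp (real k / \<alpha> * t)" by (rule exp_ge_add_one_self)
  also have "\<dots> \<le> exp (- (real k / \<alpha>) * ln (1 - t))"
  proof -
    have "ln (1 - t) \<le> - t" using ln_le_minus_one[OF A(2)] by simp
    then have "real k / \<alpha> * ln (1 - t) \<le> real k / \<alpha> * (- t)"
      using \<alpha> by (intro mult_left_mono) auto
    then show ?thesis by simp
  qed
  also have "\<dots> = (1 - t) powr (- (real k / \<alpha>))" using A(2) by (simp add: powr_def)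
  finally have "?l * (1 - real k * t) * (1 + real k / \<alpha> * t)
      \<le> ?l * (1 - real k * t) * (1 - t) powr (- (real k / \<alpha>))"
    using l0 t by (intro mult_left_mono) auto
  also have "\<dots> \<le> (spectral_radius k \<alpha> ?G * (1 - t) powr (real k / \<alpha>)) * (1 - t) powr (- (real k / \<alpha>))"
    by (rule mult_right_mono[OF le]) simp
  also have "\<dots> = spectral_radius k \<alpha> ?G"
    using A(2) by (simp add: mult.assoc powr_add[symmetric])
  finally show ?thesis by (simp add: mult.assoc)
qed

lemma spectral_radius_iso:
  assumes G: "kgraph k G" and inj: "inj_on f (verts G)"
  shows "spectral_radius k \<alpha> (f ` verts G, (`) f ` edges G) = spectral_radius k \<alpha> G"
proof -
  let ?G = "(f ` verts G, (`) f ` edges G)"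
  have e: "e \<subseteq> verts G" if "e \<in> edges G" for e using G that by (auto simp: kgraph_def)
  have "inj_on ((`) f) (edges G)"
    by (rule inj_onI) (use e inj in \<open>simp add: inj_on_image_eq_iff\<close>)
  then have poly: "lagrangian_poly k ?G y = lagrangian_poly k G (y \<circ> f)" for y
    unfolding lagrangian_poly_def
    by (simp add: sum.reindex) (intro sum.cong refl, subst prod.reindex, use e inj in \<open>auto intro: inj_on_subset\<close>)
  have norm: "alpha_norm \<alpha> (f ` verts G) y = alpha_norm \<alpha> (verts G) (y \<circ> f)" for y
    unfolding alpha_norm_def using inj by (simp add: sum.reindex)
  have "{lagrangian_poly k ?G y |y. alpha_norm \<alpha> (f ` verts G) y = 1}
      = {lagrangian_poly k G x |x. alpha_norm \<alpha> (verts G) x = 1}" (is "?L = ?R")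
  proof
    show "?L \<subseteq> ?R" unfolding poly norm by blast
    show "?R \<subseteq> ?L"
    proof
      fix p assume "p \<in> ?R"
      then obtain x where x: "p = lagrangian_poly k G x" "alpha_norm \<alpha> (verts G) x = 1" by blast
      define y where "y = x \<circ> inv_into (verts G) f"
      have y: "(y \<circ> f) i = x i" if "i \<in> verts G" for i
        using inj that by (simp add: y_def)
      have "lagrangian_poly k G (y \<circ> f) = lagrangian_poly k G x"
        using y by (rule lagrangian_poly_cong[OF G])
      then have "p = lagrangian_poly k ?G y" using poly[of y] x(1) by simp
      moreover have "alpha_norm \<alpha> (f ` verts G) y = 1"
        using norm[of y] x(2) y by (simp add: alpha_norm_def)
      ultimately show "p \<in> ?L" by blast
    qed
  qed
  then show ?thesis by (simp add: spectral_radius_def)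
qed

lemma finite_spectral_radii:
  "finite (spectral_radius k \<alpha> ` {G :: 'a::infinite hypergraph. kgraph k G \<and> card (verts G) = n})"
proof -
  obtain W :: "'a set" where W: "finite W" "card W = n"
    using infinite_arbitrarily_large[OF infinite_UNIV] by blast
  have "spectral_radius k \<alpha> G \<in> spectral_radius k \<alpha> ` (Pair W ` Pow (Pow W))"
    if G: "kgraph k G" "card (verts G) = n" for G :: "'a hypergraph"
  proof -
    have "finite (verts G)" using G by (simp add: kgraph_def)
    then obtain f where f: "bij_betw f (verts G) W"
      using finite_same_card_bij[of "verts G" W] W G by auto
    then have "f ` verts G = W" "inj_on f (verts G)" by (auto simp: bij_betw_def)
    moreover have "(`) f ` edges G \<subseteq> Pow W"
      using G \<open>f ` verts G = W\<close> by (auto simp: kgraph_def)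
    ultimately have "spectral_radius k \<alpha> G = spectral_radius k \<alpha> (W, (`) f ` edges G)"
        "(W, (`) f ` edges G) \<in> Pair W ` Pow (Pow W)"
      using spectral_radius_iso[OF G(1), of f \<alpha>] by auto
    then show ?thesis by (rule image_eqI)
  qed
  then have "spectral_radius k \<alpha> ` {G :: 'a hypergraph. kgraph k G \<and> card (verts G) = n}
      \<subseteq> spectral_radius k \<alpha> ` (Pair W ` Pow (Pow W))"
    by (intro image_subsetI) simp
  then show ?thesis by (rule finite_subset) (use W in simp)
qed

lemma spectral_radius_le_max:
  assumes "G \<in> dense_free_graphs k \<F> \<epsilon> n"
  shows "spectral_radius k \<alpha> G \<le> max_spectral_radius k \<alpha> (dense_free_graphs k \<F> \<epsilon> n)"
  unfolding max_spectral_radius_def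
proof (rule Max_ge)
  show "finite (spectral_radius k \<alpha> ` dense_free_graphs k \<F> \<epsilon> n)"
    by (rule finite_subset[OF image_mono finite_spectral_radii[of k \<alpha> n]])
       (auto simp: dense_free_graphs_def)
qed (use assms in simp)

lemma sum_le_of_powr_sum_eq_1:
  assumes V: "finite V" "V \<noteq> {}" and \<alpha>: "\<alpha> > 1"
    and x: "\<And>i. i \<in> V \<Longrightarrow> 0 \<le> x i" "(\<Sum>i\<in>V. x i powr \<alpha>) = 1"
  shows "(\<Sum>i\<in>V. x i) \<le> real (card V) powr (1 - 1 / \<alpha>)"
proof -
  let ?n = "real (card V)"
  have n: "?n > 0" using V by (simp add: card_gt_0_iff)
  define c where "c = ?n powr (1 / \<alpha>)"
  have c: "c > 0" "c powr \<alpha> = ?n" using n \<alpha> by (simp_all add: c_def powr_powr)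
  have "x i * c \<le> (x i powr \<alpha> * ?n) / \<alpha> + (1 - 1 / \<alpha>)" if "i \<in> V" for i
  proof -
    have "x i * c * 1 \<le> (x i * c) powr \<alpha> / \<alpha> + 1 powr (\<alpha> / (\<alpha> - 1)) / (\<alpha> / (\<alpha> - 1))"
      using \<alpha> x(1)[OF that] c by (intro Youngs_inequality) (auto simp: field_simps)
    moreover have "1 / (\<alpha> / (\<alpha> - 1)) = 1 - 1 / \<alpha>" using \<alpha> by (simp add: field_simps)
    ultimately show ?thesis using x(1)[OF that] c by (simp add: powr_mult)
  qed
  then have "(\<Sum>i\<in>V. x i * c) \<le> (\<Sum>i\<in>V. (x i powr \<alpha> * ?n) / \<alpha> + (1 - 1 / \<alpha>))"
    by (rule sum_mono)
  also have "\<dots> = ?n"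
    unfolding sum.distrib sum_divide_distrib[symmetric] sum_distrib_right[symmetric] x(2)
    using \<alpha> by (simp add: field_simps)
  finally have "(\<Sum>i\<in>V. x i) * c \<le> ?n" by (simp only: sum_distrib_right)
  then have "(\<Sum>i\<in>V. x i) \<le> ?n / c" using c by (simp add: pos_le_divide_eq)
  then show ?thesis using n by (simp add: c_def powr_diff)
qed

lemma powr_power_exponent:
  "n > 0 \<Longrightarrow> (real n powr (1 - 1 / \<alpha>)) ^ k = real n powr (real k - real k / \<alpha>)"
  by (simp add: powr_realpow[symmetric] powr_powr algebra_simps)

lemma spectral_radius_le:
  assumes G: "kgraph k G" "verts G \<noteq> {}" and \<alpha>: "\<alpha> > 1"
  shows "spectral_radius k \<alpha> G \<le> real (card (verts G)) powr (real k - real k / \<alpha>)"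
proof -
  have fin: "finite (verts G)" using G by (simp add: kgraph_def)
  have n: "card (verts G) > 0" using G fin by (simp add: card_gt_0_iff)
  obtain x where x: "\<And>i. 0 \<le> x i" "(\<Sum>i\<in>verts G. x i powr \<alpha>) = 1"
    "lagrangian_poly k G x = spectral_radius k \<alpha> G"
    by (rule spectral_radius_attained[OF G less_trans[OF zero_less_one \<alpha>]], rule that)
  have "spectral_radius k \<alpha> G \<le> (\<Sum>i\<in>verts G. x i) ^ k"
    unfolding x(3)[symmetric] by (rule lagrangian_poly_le_power_sum[OF G(1)]) (rule x)
  also have "\<dots> \<le> (real (card (verts G)) powr (1 - 1 / \<alpha>)) ^ k"
    by (intro power_mono sum_le_of_powr_sum_eq_1 sum_nonneg) (use fin G \<alpha> x in auto)
  finally show ?thesis unfolding powr_power_exponent[OF n] .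
qed

lemma spectral_radius_le_turan_density:
  fixes \<F> :: "'a::infinite hypergraph set"
  assumes k: "1 \<le> k" and \<alpha>: "\<alpha> > 1" and \<pi>: "turan_density k \<F> > 0" and \<delta>: "\<delta> > 0"
  shows "\<forall>\<^sub>F n in sequentially. \<forall>G :: 'a hypergraph.
    kgraph k G \<and> card (verts G) = n \<and> family_free \<F> G \<longrightarrow>
    spectral_radius k \<alpha> G \<le> (turan_density k \<F> + \<delta>) * real n powr (real k - real k / \<alpha>)"
proof -
  let ?\<pi> = "turan_density k \<F>"
  have \<pi>0: "?\<pi> \<noteq> 0" using \<pi> by simp
  have \<pi>1: "?\<pi> \<le> 1" by (rule turan_density_le_1[OF k \<pi>0])
  have "\<forall>\<^sub>F m in sequentially. edge_density k \<F> m < ?\<pi> + \<delta> \<and> k \<le> m"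
    using order_tendstoD(2)[OF edge_density_tendsto[OF k \<pi>0], of "?\<pi> + \<delta>"] \<delta>
    by (intro eventually_conj eventually_ge_at_top) auto
  then obtain m where m: "edge_density k \<F> m < ?\<pi> + \<delta>" "k \<le> m"
    unfolding eventually_sequentially by blast
  define R where "R = (\<lambda>n. real n powr (1 - 1 / \<alpha>))"
  define M where "M = (\<lambda>n. 1 / (?\<pi> * R n))"
  have p: "1 - 1 / \<alpha> > 0" using \<alpha> by simp
  have "filterlim R at_top sequentially" unfolding R_def using p by real_asymp
  then have "filterlim (\<lambda>n. ?\<pi> * R n) at_top sequentially"
    by (rule filterlim_tendsto_pos_mult_at_top[OF tendsto_const \<pi>])
  then have M0: "M \<longlonglongrightarrow> 0"
    unfolding M_def by (rule real_tendsto_divide_at_top[OF tendsto_const])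
  then have "(\<lambda>n. (?\<pi> + \<delta>) * (1 - real m * M n) ^ m) \<longlonglongrightarrow> (?\<pi> + \<delta>) * (1 - real m * 0) ^ m"
    by (intro tendsto_intros)
  then have ev1: "\<forall>\<^sub>F n in sequentially. edge_density k \<F> m < (?\<pi> + \<delta>) * (1 - real m * M n) ^ m"
    by (rule order_tendstoD) (use m in simp)
  have "(\<lambda>n. real m * M n) \<longlonglongrightarrow> real m * 0" by (intro tendsto_intros M0)
  then have ev2: "\<forall>\<^sub>F n in sequentially. real m * M n < 1"
    by (rule order_tendstoD) simp
  show ?thesis
    using ev1 ev2 eventually_gt_at_top[of 0]
  proof eventually_elim
    case (elim n)
    show ?case
    proof (intro allI impI, elim conjE)
      fix G :: "'a hypergraph"
      assume G: "kgraph k G" "card (verts G) = n" "family_free \<F> G"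
      have V: "finite (verts G)" "verts G \<noteq> {}"
        using G elim by (auto simp: kgraph_def)
      obtain x where x: "\<And>i. 0 \<le> x i" "(\<Sum>i\<in>verts G. x i powr \<alpha>) = 1"
        "lagrangian_poly k G x = spectral_radius k \<alpha> G"
        by (rule spectral_radius_attained[OF G(1) V(2) less_trans[OF zero_less_one \<alpha>]], rule that)
      let ?S = "\<Sum>i\<in>verts G. x i"
      have R: "R n > 0" "(R n) ^ k = real n powr (real k - real k / \<alpha>)"
        using elim by (simp_all add: R_def powr_power_exponent)
      have S0: "0 \<le> ?S" by (intro sum_nonneg x)
      have SR: "?S \<le> R n"
        unfolding R_def G(2)[symmetric] by (rule sum_le_of_powr_sum_eq_1) (use V \<alpha> x in auto)
      show "spectral_radius k \<alpha> G \<le> (?\<pi> + \<delta>) * real n powr (real k - real k / \<alpha>)"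
        unfolding R(2)[symmetric]
      proof (cases "?S \<le> ?\<pi> * R n")
        case True
        have "spectral_radius k \<alpha> G \<le> ?S ^ k"
          unfolding x(3)[symmetric] by (rule lagrangian_poly_le_power_sum[OF G(1)]) (rule x)
        also have "\<dots> \<le> (?\<pi> * R n) ^ k" by (rule power_mono[OF True S0])
        also have "\<dots> \<le> ?\<pi> * R n ^ k"
          unfolding power_mult_distrib
          by (rule mult_right_mono) (use power_decreasing[of 1 k ?\<pi>] \<pi> \<pi>1 k R in auto)
        also have "\<dots> \<le> (?\<pi> + \<delta>) * R n ^ k"
          by (rule mult_right_mono) (use \<delta> R in auto)
        finally show "spectral_radius k \<alpha> G \<le> (?\<pi> + \<delta>) * R n ^ k" .
      next
        case False
        then have S: "?S > ?\<pi> * R n" by simp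
        moreover have "?\<pi> * R n > 0" using \<pi> R by simp
        ultimately have S: "?S > ?\<pi> * R n" "?S > 0" by linarith+
        define z where "z = (\<lambda>i. (1 / ?S) * x i)"
        have z: "0 \<le> z i \<and> z i \<le> M n" if "i \<in> verts G" for i
        proof -
          have "x i powr \<alpha> \<le> 1"
            using member_le_sum[OF that, of "\<lambda>i. x i powr \<alpha>"] V x by simp
          then have "x i \<le> 1"
            using \<alpha> powr_less_mono2[of \<alpha> 1 "x i"] by fastforce
          then have "z i \<le> 1 / ?S" using S by (simp add: z_def divide_right_mono)
          also have "\<dots> \<le> M n"
            unfolding M_def using S \<pi> R by (intro divide_left_mono) auto
          finally show ?thesis using S x by (simp add: z_def)
        qed
        have z1: "(\<Sum>i\<in>verts G. z i) = 1"
          using S unfolding z_def sum_distrib_left[symmetric] by simp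
        have "0 \<le> M n" using \<pi> R by (simp add: M_def)
        then have "lagrangian_poly k G z * (1 - real m * M n) ^ m \<le> edge_density k \<F> m"
          by (intro lagrangian_poly_le_edge_density) (use G z z1 elim m in auto)
        also have "\<dots> \<le> (?\<pi> + \<delta>) * (1 - real m * M n) ^ m" using elim by simp
        finally have Pz: "lagrangian_poly k G z \<le> ?\<pi> + \<delta>"
          using elim by (simp add: mult_le_cancel_right_pos)
        have "lagrangian_poly k G z = (1 / ?S) ^ k * spectral_radius k \<alpha> G"
          unfolding z_def lagrangian_poly_scale[OF G(1)] x(3) by simp
        then have "spectral_radius k \<alpha> G = ?S ^ k * lagrangian_poly k G z"
          using S by (simp add: power_divide)
        also have "\<dots> \<le> R n ^ k * (?\<pi> + \<delta>)"
          using Pz SR S0 R \<pi> \<delta> by (intro mult_mono power_mono lagrangian_poly_nonneg[OF G(1)]) (auto simp: z)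
        finally show "spectral_radius k \<alpha> G \<le> (?\<pi> + \<delta>) * R n ^ k" by (simp add: mult.commute)
      qed
    qed
  qed
qed

lemma powr_ge_self:
  assumes "0 \<le> a" "a \<le> 1" "0 \<le> p" "p \<le> 1"
  shows "(a::real) \<le> a powr p"
proof (cases "a = 0")
  case False
  then show ?thesis using assms powr_mono'[of p 1 a] by simp
qed simp

lemma spectral_radius_le_degree:
  assumes G: "kgraph k G" "card (verts G) = n" and k: "1 \<le> k" and \<alpha>: "\<alpha> > 1"
    and x: "\<And>i. 0 \<le> x i" "(\<Sum>i\<in>verts G. x i powr \<alpha>) = 1"
      "lagrangian_poly k G x = spectral_radius k \<alpha> G"
    and \<eta>: "0 \<le> \<eta>" "\<eta> < 1" and heavy: "\<And>i. i \<in> verts G \<Longrightarrow> (1 - \<eta>) / real n \<le> x i powr \<alpha>"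
    and u: "u \<in> verts G"
  shows "spectral_radius k \<alpha> G * (1 - \<eta>) * real n powr (real k / \<alpha> - 1)
    \<le> real n ^ (k - 1) - (1 - \<eta>) ^ (k - 1) * (fact (k - 1) * (real (n choose (k - 1)) - real (degree G u)))"
proof -
  let ?V = "verts G" and ?l = "spectral_radius k \<alpha> G"
  have V: "finite ?V" "?V \<noteq> {}" using G u by (auto simp: kgraph_def)
  have n: "real n > 0" using V G by (auto simp: card_gt_0_iff)
  have l0: "0 \<le> ?l" by (rule spectral_radius_nonneg) (use G V \<alpha> in auto)
  define c where "c = real n powr (1 / \<alpha>)"
  have c: "c > 0" "c powr \<alpha> = real n" using n \<alpha> by (simp_all add: c_def powr_powr)
  define w where "w = (\<lambda>i. c * x i)"
  have w0: "0 \<le> w i" for i using x c by (simp add: w_def)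
  have wa: "1 - \<eta> \<le> w i powr \<alpha>" if "i \<in> ?V" for i
    using heavy[OF that] n x c by (simp add: w_def powr_mult field_simps)
  have root: "(1 - \<eta>) \<le> w i powr p" if "i \<in> ?V" "0 \<le> p" "p \<le> \<alpha>" for i p
  proof -
    have "1 - \<eta> \<le> (1 - \<eta>) powr (p / \<alpha>)" by (rule powr_ge_self) (use \<eta> that \<alpha> in auto)
    also have "\<dots> \<le> (w i powr \<alpha>) powr (p / \<alpha>)"
      by (rule powr_mono2) (use wa that \<eta> \<alpha> in auto)
    finally show ?thesis using \<alpha> by (simp add: powr_powr)
  qed
  have w1: "1 - \<eta> \<le> w i" if "i \<in> ?V" for i
    using root[OF that, of 1] \<alpha> w0[of i] by simp
  have sumw: "(\<Sum>i\<in>?V. w i) \<le> real n"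
  proof -
    have "(\<Sum>i\<in>?V. x i) \<le> real n powr (1 - 1 / \<alpha>)"
      using sum_le_of_powr_sum_eq_1[OF V \<alpha>, of x] x G by simp
    then have "c * (\<Sum>i\<in>?V. x i) \<le> c * real n powr (1 - 1 / \<alpha>)" using c by simp
    also have "\<dots> = real n" using n by (simp add: c_def powr_add[symmetric])
    finally show ?thesis by (simp add: w_def sum_distrib_left)
  qed
  let ?b = "(1 - \<eta>) ^ (k - 1)"
  let ?E = "{e. e \<in> edges G \<and> u \<in> e}"
  let ?S = "{S. S \<subseteq> ?V \<and> card S = k - 1}"
  have finE: "finite ?E" using finite_edges[OF G(1)] by simp
  have e: "finite e" "e \<subseteq> ?V" "card e = k" if "e \<in> edges G" for e
    using G that by (auto simp: kgraph_def intro: finite_subset)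
  have prod_ge: "?b \<le> (\<Prod>i\<in>S. w i)" if "S \<in> ?S" for S
  proof -
    have "(\<Prod>i\<in>S. 1 - \<eta>) \<le> (\<Prod>i\<in>S. w i)"
      by (rule prod_mono) (use that w1 \<eta> in auto)
    then show ?thesis using that by simp
  qed
  \<comment> \<open>All products exceed \<open>(1 - \<eta>)\<^bsup>k-1\<^esup>\<close>, so the excess over the link is at most the excess over
    all \<open>(k - 1)\<close>-sets; this keeps the loss linear in \<open>\<eta>\<close>.\<close>
  have inj: "inj_on (\<lambda>e. e - {u}) ?E" by (rule inj_onI) blast
  have "link_sum G u w - ?b * real (degree G u) = (\<Sum>e\<in>?E. (\<Prod>i\<in>e - {u}. w i) - ?b)"
    by (simp add: link_sum_def degree_def sum_subtractf)
  also have "\<dots> = (\<Sum>S\<in>(\<lambda>e. e - {u}) ` ?E. (\<Prod>i\<in>S. w i) - ?b)"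
    by (simp add: sum.reindex[OF inj])
  also have "\<dots> \<le> (\<Sum>S\<in>?S. (\<Prod>i\<in>S. w i) - ?b)"
  proof (rule sum_mono2)
    show "finite ?S" using V by simp
    show "(\<lambda>e. e - {u}) ` ?E \<subseteq> ?S"
      using e by (auto simp: card_Diff_singleton)
    show "0 \<le> (\<Prod>i\<in>S. w i) - ?b" if "S \<in> ?S - (\<lambda>e. e - {u}) ` ?E" for S
      using prod_ge[of S] that by simp
  qed
  also have "\<dots> = esym w ?V (k - 1) - ?b * real (n choose (k - 1))"
    using V G by (simp add: esym_def sum_subtractf n_subsets)
  finally have "fact (k - 1) * (link_sum G u w - ?b * real (degree G u))
      \<le> fact (k - 1) * (esym w ?V (k - 1) - ?b * real (n choose (k - 1)))"
    by (rule mult_left_mono) simp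
  moreover have "fact (k - 1) * esym w ?V (k - 1) \<le> real n ^ (k - 1)"
  proof -
    have "fact (k - 1) * esym w ?V (k - 1) \<le> (\<Sum>i\<in>?V. w i) ^ (k - 1)"
      by (rule esym_le_power_sum) (use V w0 in auto)
    also have "\<dots> \<le> real n ^ (k - 1)"
      by (rule power_mono[OF sumw]) (simp add: sum_nonneg w0)
    finally show ?thesis .
  qed
  ultimately have upper: "fact (k - 1) * link_sum G u w
      \<le> real n ^ (k - 1) - ?b * (fact (k - 1) * (real (n choose (k - 1)) - real (degree G u)))"
    by (simp add: algebra_simps)
  have "x u > 0"
  proof -
    have "w u > 0" using w1[OF u] \<eta> by simp
    then show ?thesis using c by (simp add: w_def zero_less_mult_iff)
  qed
  then have "fact k * link_sum G u x = real k * ?l * x u powr (\<alpha> - 1)"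
    by (intro stationary) (use G V \<alpha> x u in auto)
  moreover have "(fact k :: real) = real k * fact (k - 1)" using k by (simp add: fact_reduce)
  ultimately have stat: "fact (k - 1) * link_sum G u x = ?l * x u powr (\<alpha> - 1)" using k by simp
  have "link_sum G u w = (\<Sum>e\<in>?E. c ^ (k - 1) * (\<Prod>i\<in>e - {u}. x i))"
    unfolding link_sum_def w_def prod.distrib using e by (intro sum.cong) auto
  then have "link_sum G u w = c ^ (k - 1) * link_sum G u x"
    by (simp add: link_sum_def sum_distrib_left)
  then have "fact (k - 1) * link_sum G u w = ?l * (c ^ (k - 1) * x u powr (\<alpha> - 1))"
    using stat by (simp add: mult_ac)
  also have "c ^ (k - 1) * x u powr (\<alpha> - 1) = w u powr (\<alpha> - 1) * real n powr (real k / \<alpha> - 1)"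
  proof -
    have "c ^ (k - 1) = real n powr (real (k - 1) / \<alpha>)"
      using n c by (simp add: c_def powr_realpow[symmetric] powr_powr)
    moreover have "w u powr (\<alpha> - 1) = real n powr ((\<alpha> - 1) / \<alpha>) * x u powr (\<alpha> - 1)"
      using n x c by (simp add: w_def powr_mult c_def powr_powr)
    moreover have "real (k - 1) / \<alpha> = (\<alpha> - 1) / \<alpha> + (real k / \<alpha> - 1)"
      using k \<alpha> by (simp add: of_nat_diff field_simps)
    ultimately show ?thesis by (simp add: powr_add)
  qed
  finally have "fact (k - 1) * link_sum G u w = ?l * (w u powr (\<alpha> - 1) * real n powr (real k / \<alpha> - 1))" .
  moreover have "?l * ((1 - \<eta>) * real n powr (real k / \<alpha> - 1))
      \<le> ?l * (w u powr (\<alpha> - 1) * real n powr (real k / \<alpha> - 1))"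
    by (intro mult_left_mono mult_right_mono root) (use u \<alpha> l0 in auto)
  ultimately show ?thesis using upper by (simp add: mult.assoc)
qed

lemma exists_light_vertex:
  fixes \<F> :: "'a::infinite hypergraph set" and k :: nat and \<alpha> \<epsilon> \<eta> :: real
  defines "\<pi> \<equiv> turan_density k \<F>"
  assumes k: "1 \<le> k" and \<alpha>: "\<alpha> > 1" and \<epsilon>: "0 < \<epsilon>" "\<epsilon> < 1" and \<pi>: "0 < \<pi>"
    and \<eta>: "0 \<le> \<eta>" "\<eta> < 1" "(real k + 1) * \<eta> < \<epsilon> * \<pi>"
  shows "\<forall>\<^sub>F n in sequentially. \<forall>(G :: 'a hypergraph) x.
    kgraph k G \<and> card (verts G) = n \<and> family_free \<F> G \<and> G \<notin> dense_free_graphs k \<F> \<epsilon> n \<and>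
    (1 - \<eta>) * \<pi> * real n powr (real k - real k / \<alpha>) \<le> spectral_radius k \<alpha> G \<and>
    (\<forall>i. 0 \<le> x i) \<and> (\<Sum>i\<in>verts G. x i powr \<alpha>) = 1 \<and>
    lagrangian_poly k G x = spectral_radius k \<alpha> G \<longrightarrow>
    (\<exists>u\<in>verts G. x u powr \<alpha> < (1 - \<eta>) / real n)"
proof -
  have \<pi>1: "\<pi> \<le> 1" unfolding \<pi>_def by (rule turan_density_le_1[OF k]) (use \<pi> \<pi>_def in auto)
  define \<theta> where "\<theta> = (\<epsilon> * \<pi> - (real k + 1) * \<eta>) / 2"
  have \<theta>: "\<theta> > 0" using \<eta> by (simp add: \<theta>_def)
  have "(\<lambda>n. (1 - real (k - 1) / real n) ^ (k - 1)) \<longlonglongrightarrow> (1 - 0) ^ (k - 1)"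
    by (intro tendsto_intros lim_const_over_n)
  then have ev: "\<forall>\<^sub>F n in sequentially. 1 - \<theta> < (1 - real (k - 1) / real n) ^ (k - 1)"
    by (rule order_tendstoD) (use \<theta> in simp)
  show ?thesis
    using ev eventually_ge_at_top[of k]
  proof eventually_elim
    case (elim n)
    show ?case
    proof (intro allI impI, elim conjE, rule ccontr)
      fix G :: "'a hypergraph" and x
      assume G: "kgraph k G" "card (verts G) = n" "family_free \<F> G"
        and nd: "G \<notin> dense_free_graphs k \<F> \<epsilon> n"
        and l: "(1 - \<eta>) * \<pi> * real n powr (real k - real k / \<alpha>) \<le> spectral_radius k \<alpha> G"
        and x: "\<forall>i. 0 \<le> x i" "(\<Sum>i\<in>verts G. x i powr \<alpha>) = 1"
          "lagrangian_poly k G x = spectral_radius k \<alpha> G"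
        and "\<not> (\<exists>u\<in>verts G. x u powr \<alpha> < (1 - \<eta>) / real n)"
      then have heavy: "(1 - \<eta>) / real n \<le> x i powr \<alpha>" if "i \<in> verts G" for i
        using that by force
      have n: "real n > 0" using elim k by simp
      have V: "finite (verts G)" "verts G \<noteq> {}" using G n by (auto simp: kgraph_def)
      have "min_degree G \<in> degree G ` verts G"
        unfolding min_degree_def using V by (intro Min_in) auto
      then obtain u where u: "u \<in> verts G" "degree G u = min_degree G" by auto
      let ?B = "fact (k - 1) * real (n choose (k - 1))" and ?N = "real n ^ (k - 1)"
      let ?b = "(1 - \<eta>) ^ (k - 1)" and ?g = "1 - (1 - \<epsilon>) * \<pi>"
      have g: "0 \<le> ?g" "?g \<le> 1" using \<epsilon> \<pi> \<pi>1 mult_mono[of "1 - \<epsilon>" 1 \<pi> 1] by auto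
      have "real (degree G u) \<le> (1 - \<epsilon>) * \<pi> * real (n choose (k - 1))"
        using nd G u by (simp add: dense_free_graphs_def \<pi>_def)
      then have "fact (k - 1) * real (degree G u) \<le> (1 - \<epsilon>) * \<pi> * ?B"
        using mult_left_mono[of "real (degree G u)" _ "fact (k - 1)"] by (simp add: mult_ac)
      then have deg: "?B * ?g \<le> fact (k - 1) * (real (n choose (k - 1)) - real (degree G u))"
        by (simp add: algebra_simps)
      have "(1 - \<theta>) * ?N \<le> (1 - real (k - 1) / real n) ^ (k - 1) * ?N"
        using elim n by (intro mult_right_mono) auto
      also have "\<dots> = (real n - real (k - 1)) ^ (k - 1)"
        using n by (simp add: power_mult_distrib[symmetric] field_simps)
      also have "\<dots> \<le> ?B" by (rule falling_power_ge) (use elim in simp)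
      finally have B: "(1 - \<theta>) * ?N \<le> ?B" .
      have b: "1 - real (k - 1) * \<eta> \<le> ?b" "?b \<le> 1" "0 \<le> ?b"
        using Bernoulli_inequality[of "- \<eta>" "k - 1"] \<eta> by (simp_all add: power_le_one)
      have pw: "real n powr (real k - real k / \<alpha>) * real n powr (real k / \<alpha> - 1) = ?N"
        using n k by (simp add: powr_add[symmetric] powr_realpow[symmetric] of_nat_diff)
      have "(1 - \<eta>) * \<pi> * real n powr (real k - real k / \<alpha>) * (1 - \<eta>) * real n powr (real k / \<alpha> - 1)
          \<le> spectral_radius k \<alpha> G * (1 - \<eta>) * real n powr (real k / \<alpha> - 1)"
        using l \<eta> by (intro mult_right_mono) auto
      also have "\<dots> \<le> ?N - ?b * (fact (k - 1) * (real (n choose (k - 1)) - real (degree G u)))"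
        by (rule spectral_radius_le_degree) (use G k \<alpha> x \<eta> heavy u in auto)
      also have "\<dots> \<le> ?N - ?b * (?B * ?g)"
        using mult_left_mono[OF deg b(3)] by simp
      also have "\<dots> \<le> ?N - ?b * ((1 - \<theta>) * ?N * ?g)"
        using mult_left_mono[OF mult_right_mono[OF B g(1)] b(3)] by simp
      also have "\<dots> = (1 - ?b * (1 - \<theta>) * ?g) * ?N" by (simp add: algebra_simps)
      finally have "((1 - \<eta>) * (1 - \<eta>) * \<pi>) * ?N \<le> (1 - ?b * (1 - \<theta>) * ?g) * ?N"
        using pw by (simp add: mult_ac)
      then have main: "(1 - \<eta>) * (1 - \<eta>) * \<pi> \<le> 1 - ?b * (1 - \<theta>) * ?g" using n by simp
      have "?b * (1 - \<theta>) \<ge> ?b - \<theta>"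
        using mult_right_mono[OF b(2), of \<theta>] \<theta> by (simp add: algebra_simps)
      then have "1 - real (k - 1) * \<eta> - \<theta> \<le> ?b * (1 - \<theta>)" using b by linarith
      then have "(1 - (real (k - 1) * \<eta> + \<theta>)) * ?g \<le> ?b * (1 - \<theta>) * ?g"
        using g by (intro mult_right_mono) auto
      moreover have "?g - (real (k - 1) * \<eta> + \<theta>) \<le> (1 - (real (k - 1) * \<eta> + \<theta>)) * ?g"
      proof -
        have "(real (k - 1) * \<eta> + \<theta>) * ?g \<le> (real (k - 1) * \<eta> + \<theta>) * 1"
          using g \<eta> \<theta> by (intro mult_left_mono) auto
        then show ?thesis by (simp add: left_diff_distrib)
      qed
      ultimately have "(1 - \<eta>) * (1 - \<eta>) * \<pi> \<le> (1 - \<epsilon>) * \<pi> + real (k - 1) * \<eta> + \<theta>"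
        using main by linarith
      moreover have "\<pi> - 2 * \<eta> * \<pi> + \<eta> * \<eta> * \<pi> = (1 - \<eta>) * (1 - \<eta>) * \<pi>" by (simp add: algebra_simps)
      moreover have "0 \<le> \<eta> * \<eta> * \<pi>" using \<pi> by simp
      moreover have "2 * \<eta> * \<pi> \<le> 2 * \<eta>" using \<eta> \<pi>1 by (simp add: mult_left_le)
      moreover have "real (k - 1) * \<eta> = real k * \<eta> - \<eta>" using k by (simp add: of_nat_diff algebra_simps)
      ultimately have "\<epsilon> * \<pi> \<le> real k * \<eta> + \<eta> + \<theta>" by (simp add: algebra_simps)
      then show False using \<theta> unfolding \<theta>_def by (simp add: field_simps)
    qed
  qed
qed

section \<open>Descent by deleting light vertices\<close>

lemma sum_powr_lower_bound:
  fixes s \<delta> :: real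
  assumes s: "0 < s" and \<delta>: "0 < \<delta>" "\<delta> < 1"
  shows "\<forall>\<^sub>F n in sequentially. (1 - \<delta>) * real n powr s \<le> (\<Sum>i\<in>{m<..n}. s * real i powr (s - 1))"
proof -
  have "\<forall>\<^sub>F i in sequentially. (1 - \<delta> / 2) * (real i powr s - (real i - 1) powr s) \<le> s * real i powr (s - 1)"
    using s \<delta> by real_asymp
  then obtain M where M: "\<And>i. i \<ge> M \<Longrightarrow>
      (1 - \<delta> / 2) * (real i powr s - (real i - 1) powr s) \<le> s * real i powr (s - 1)"
    unfolding eventually_sequentially by blast
  define L where "L = max m M"
  have tel: "(1 - \<delta> / 2) * (real n powr s - real L powr s) \<le> (\<Sum>i\<in>{L<..n}. s * real i powr (s - 1))"
    if "n \<ge> L" for n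
    using that
  proof (induction n rule: dec_induct)
    case (step n)
    have "{L<..Suc n} = insert (Suc n) {L<..n}" using step by auto
    then have "(\<Sum>i\<in>{L<..Suc n}. s * real i powr (s - 1))
        = s * real (Suc n) powr (s - 1) + (\<Sum>i\<in>{L<..n}. s * real i powr (s - 1))" by simp
    moreover have "(1 - \<delta> / 2) * (real (Suc n) powr s - real n powr s) \<le> s * real (Suc n) powr (s - 1)"
      using M[of "Suc n"] step by (simp add: L_def)
    ultimately show ?case using step.IH by (simp add: right_diff_distrib)
  qed simp
  have "filterlim (\<lambda>n. real n powr s) at_top sequentially" using s by real_asymp
  then have "\<forall>\<^sub>F n in sequentially. 2 / \<delta> * real L powr s \<le> real n powr s"
    unfolding filterlim_at_top by blast
  then show ?thesis using eventually_ge_at_top[of L]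
  proof eventually_elim
    case (elim n)
    have "(1 - \<delta> / 2) * real L powr s \<le> 1 * real L powr s"
      using \<delta> by (intro mult_right_mono) auto
    also have "\<dots> \<le> \<delta> / 2 * real n powr s" using elim \<delta> by (simp add: field_simps)
    finally have "(1 - \<delta>) * real n powr s \<le> (1 - \<delta> / 2) * (real n powr s - real L powr s)"
      by (simp add: algebra_simps)
    also have "\<dots> \<le> (\<Sum>i\<in>{L<..n}. s * real i powr (s - 1))" by (rule tel) (use elim in simp)
    also have "\<dots> \<le> (\<Sum>i\<in>{m<..n}. s * real i powr (s - 1))"
      by (rule sum_mono2) (use s in \<open>auto simp: L_def\<close>)
    finally show ?case .
  qed
qed

lemma recurrence_lower_bound:
  fixes D :: "nat \<Rightarrow> real"
  assumes s: "0 < s" and c: "0 < c" "c' < c"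
    and rec: "\<And>n. n \<ge> N \<Longrightarrow> D (n - 1) + s * c * real n powr (s - 1) \<le> D n"
  shows "\<forall>\<^sub>F n in sequentially. c' * real n powr s \<le> D n"
proof -
  define \<delta> where "\<delta> = min (1 / 2) ((c - c') / (2 * c))"
  have \<delta>: "0 < \<delta>" "\<delta> < 1" using c by (auto simp: \<delta>_def)
  have "c * \<delta> \<le> c * ((c - c') / (2 * c))" using c by (intro mult_left_mono) (auto simp: \<delta>_def)
  then have c\<delta>: "c * \<delta> \<le> (c - c') / 2" using c by simp
  have sum: "D N + c * (\<Sum>i\<in>{N<..n}. s * real i powr (s - 1)) \<le> D n" if "n \<ge> N" for n
    using that
  proof (induction n rule: dec_induct)
    case (step n)
    have "{N<..Suc n} = insert (Suc n) {N<..n}" using step by auto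
    then show ?case using step rec[of "Suc n"] by (simp add: algebra_simps)
  qed simp
  have "filterlim (\<lambda>n. real n powr s) at_top sequentially" using s by real_asymp
  then have "\<forall>\<^sub>F n in sequentially. (- 2 * D N) / (c - c') \<le> real n powr s"
    unfolding filterlim_at_top by blast
  then show ?thesis
    using sum_powr_lower_bound[OF s \<delta>, of N] eventually_ge_at_top[of N]
  proof eventually_elim
    case (elim n)
    have "- 2 * D N \<le> real n powr s * (c - c')"
      using elim(1) c by (simp only: pos_divide_le_eq diff_gt_0_iff_gt)
    then have "- D N \<le> (c - c') / 2 * real n powr s" by (simp add: mult.commute)
    moreover have "c * \<delta> * real n powr s \<le> (c - c') / 2 * real n powr s"
      by (rule mult_right_mono[OF c\<delta>]) simp
    moreover have "c * ((1 - \<delta>) * real n powr s) \<le> c * (\<Sum>i\<in>{N<..n}. s * real i powr (s - 1))"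
      using elim c by (intro mult_left_mono) auto
    ultimately show ?case using sum[OF elim(3)] by (simp add: algebra_simps)
  qed
qed

lemma exists_vertex_deletion:
  fixes \<F> :: "'a::infinite hypergraph set" and k :: nat and \<alpha> \<epsilon> \<epsilon>' \<eta> :: real
  defines "\<pi> \<equiv> turan_density k \<F>" and "s \<equiv> real k - real k / \<alpha>"
  assumes k: "1 \<le> k" and \<alpha>: "\<alpha> > 1" and \<epsilon>: "0 < \<epsilon>" "\<epsilon> < 1" and \<pi>: "0 < \<pi>"
    and \<eta>: "0 \<le> \<epsilon>'" "\<epsilon>' < \<eta>" "\<eta> < 1" "(real k + 1) * \<eta> < \<epsilon> * \<pi>"
  obtains \<kappa> where "\<kappa> > 0" and
    "\<forall>\<^sub>F n in sequentially. \<forall>G :: 'a hypergraph.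
      kgraph k G \<and> card (verts G) = n \<and> family_free \<F> G \<and> G \<notin> dense_free_graphs k \<F> \<epsilon> n \<and>
      (1 - \<eta>) * \<pi> * real n powr s \<le> spectral_radius k \<alpha> G \<longrightarrow>
      (\<exists>G' :: 'a hypergraph. kgraph k G' \<and> card (verts G') = n - 1 \<and> family_free \<F> G' \<and>
        spectral_radius k \<alpha> G - spectral_radius k \<alpha> G' \<le> (s * (1 - \<epsilon>') * \<pi> - \<kappa>) * real n powr (s - 1))"
proof -
  have s: "s > 0" using k \<alpha> by (simp add: s_def field_simps)
  define \<delta> where "\<delta> = \<pi> * (\<eta> - \<epsilon>') / 2"
  have \<delta>: "\<delta> > 0" using \<pi> \<eta> by (simp add: \<delta>_def)
  define \<kappa> where "\<kappa> = s * \<delta> / 2"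
  have \<kappa>: "\<kappa> > 0" using s \<delta> by (simp add: \<kappa>_def)
  have "(\<lambda>n. (\<pi> + \<delta>) * (real k * (real k / \<alpha>)) / real n) \<longlonglongrightarrow> 0" by (rule lim_const_over_n)
  then have ev: "\<forall>\<^sub>F n in sequentially. (\<pi> + \<delta>) * (real k * (real k / \<alpha>)) / real n < \<kappa>"
    by (rule order_tendstoD) (rule \<kappa>)
  have light: "\<forall>\<^sub>F n in sequentially. \<forall>(G :: 'a hypergraph) x.
    kgraph k G \<and> card (verts G) = n \<and> family_free \<F> G \<and> G \<notin> dense_free_graphs k \<F> \<epsilon> n \<and>
    (1 - \<eta>) * \<pi> * real n powr s \<le> spectral_radius k \<alpha> G \<and>
    (\<forall>i. 0 \<le> x i) \<and> (\<Sum>i\<in>verts G. x i powr \<alpha>) = 1 \<and>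
    lagrangian_poly k G x = spectral_radius k \<alpha> G \<longrightarrow>
    (\<exists>u\<in>verts G. x u powr \<alpha> < (1 - \<eta>) / real n)"
    unfolding \<pi>_def s_def
    by (rule exists_light_vertex) (use k \<alpha> \<epsilon> \<pi> \<eta> in \<open>auto simp: \<pi>_def\<close>)
  have upper: "\<forall>\<^sub>F n in sequentially. \<forall>G :: 'a hypergraph.
    kgraph k G \<and> card (verts G) = n \<and> family_free \<F> G \<longrightarrow>
    spectral_radius k \<alpha> G \<le> (\<pi> + \<delta>) * real n powr s"
    unfolding \<pi>_def s_def
    by (rule spectral_radius_le_turan_density) (use k \<alpha> \<pi> \<delta> in \<open>auto simp: \<pi>_def\<close>)
  have "\<forall>\<^sub>F n in sequentially. \<forall>G :: 'a hypergraph.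
      kgraph k G \<and> card (verts G) = n \<and> family_free \<F> G \<and> G \<notin> dense_free_graphs k \<F> \<epsilon> n \<and>
      (1 - \<eta>) * \<pi> * real n powr s \<le> spectral_radius k \<alpha> G \<longrightarrow>
      (\<exists>G' :: 'a hypergraph. kgraph k G' \<and> card (verts G') = n - 1 \<and> family_free \<F> G' \<and>
        spectral_radius k \<alpha> G - spectral_radius k \<alpha> G' \<le> (s * (1 - \<epsilon>') * \<pi> - \<kappa>) * real n powr (s - 1))"
    using ev light upper eventually_ge_at_top[of "max 2 k"]
  proof eventually_elim
    case (elim n)
    show ?case
    proof (intro allI impI, elim conjE)
      fix G :: "'a hypergraph"
      assume G: "kgraph k G" "card (verts G) = n" "family_free \<F> G"
        and nd: "G \<notin> dense_free_graphs k \<F> \<epsilon> n"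
        and l: "(1 - \<eta>) * \<pi> * real n powr s \<le> spectral_radius k \<alpha> G"
      let ?l = "spectral_radius k \<alpha> G"
      have n: "real n > 0" "n \<ge> 2" "k \<le> n" using elim by auto
      have V: "finite (verts G)" "verts G \<noteq> {}" using G n by (auto simp: kgraph_def)
      obtain x where x: "\<And>i. 0 \<le> x i" "(\<Sum>i\<in>verts G. x i powr \<alpha>) = 1"
        "lagrangian_poly k G x = ?l"
        by (rule spectral_radius_attained[OF G(1) V(2) less_trans[OF zero_less_one \<alpha>]], rule that)
      then obtain u where u: "u \<in> verts G" "x u powr \<alpha> < (1 - \<eta>) / real n"
        using elim(2) G nd l by blast
      define t where "t = x u powr \<alpha>"
      have t0: "0 \<le> t" by (simp add: t_def)
      have tn: "t \<le> (1 - \<eta>) / real n" using u by (simp add: t_def)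
      have t1n: "t \<le> 1 / real n"
        using tn divide_right_mono[of "1 - \<eta>" 1 "real n"] n \<eta> by simp
      have "1 / real n \<le> 1 / 2" using n by simp
      then have t1: "t < 1" using t1n by linarith
      have kt: "real k * t \<le> 1"
        using mult_mono[of "real k" "real n" t "1 / real n"] n t1n t0 by simp
      let ?G = "induced G (verts G - {u})"
      have card': "card (verts G - {u}) = n - 1" using u G V by simp
      have "card (verts G - {u}) \<noteq> 0" using card' n(2) by linarith
      then have "verts G - {u} \<noteq> {}" by (rule contrapos_nn) (simp only: card.empty)
      then have "?l * ((1 - real k * t) * (1 + real k / \<alpha> * t)) \<le> spectral_radius k \<alpha> ?G"
        by (intro spectral_radius_delete_vertex) (use G \<alpha> x u t1 kt in \<open>auto simp: t_def\<close>)
      moreover have "(1 - real k * t) * (1 + real k / \<alpha> * t) = 1 - (s * t + real k * (real k / \<alpha>) * (t * t))"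
        by (simp add: s_def algebra_simps diff_divide_distrib)
      ultimately have "?l - spectral_radius k \<alpha> ?G \<le> ?l * (s * t + real k * (real k / \<alpha>) * (t * t))"
        by (simp add: right_diff_distrib)
      also have "\<dots> \<le> ((\<pi> + \<delta>) * real n powr s) *
          (s * ((1 - \<eta>) / real n) + real k * (real k / \<alpha>) * (1 / real n * (1 / real n)))"
      proof (intro mult_mono add_mono)
        show "?l \<le> (\<pi> + \<delta>) * real n powr s" using elim(3) G by blast
      qed (use \<pi> \<delta> s tn t1n t0 \<alpha> in auto)
      also have "\<dots> = ((\<pi> + \<delta>) * s * (1 - \<eta>) + (\<pi> + \<delta>) * (real k * (real k / \<alpha>)) / real n) * real n powr (s - 1)"
        using n by (simp add: powr_diff field_simps add_divide_distrib)
      also have "\<dots> \<le> (s * (1 - \<epsilon>') * \<pi> - \<kappa>) * real n powr (s - 1)"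
      proof (rule mult_right_mono)
        have "\<delta> * (1 - \<eta>) \<le> \<delta> * 1" using \<delta> \<eta> by (intro mult_left_mono) auto
        moreover have "\<pi> * (1 - \<eta>) = (1 - \<epsilon>') * \<pi> - 2 * \<delta>" by (simp add: \<delta>_def field_simps)
        ultimately have "(\<pi> + \<delta>) * (1 - \<eta>) \<le> (1 - \<epsilon>') * \<pi> - \<delta>" by (simp add: distrib_right)
        from mult_left_mono[OF this, of s] s
        have "(\<pi> + \<delta>) * s * (1 - \<eta>) \<le> s * (1 - \<epsilon>') * \<pi> - 2 * \<kappa>"
          by (simp add: \<kappa>_def algebra_simps)
        then show "(\<pi> + \<delta>) * s * (1 - \<eta>) + (\<pi> + \<delta>) * (real k * (real k / \<alpha>)) / real n
            \<le> s * (1 - \<epsilon>') * \<pi> - \<kappa>"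
          using elim(1) by linarith
      qed simp
      finally have "?l - spectral_radius k \<alpha> ?G \<le> (s * (1 - \<epsilon>') * \<pi> - \<kappa>) * real n powr (s - 1)" .
      moreover have "kgraph k ?G" "family_free \<F> ?G"
        using G by (auto intro: kgraph_induced family_free_induced)
      ultimately show "\<exists>G' :: 'a hypergraph. kgraph k G' \<and> card (verts G') = n - 1 \<and> family_free \<F> G' \<and>
        ?l - spectral_radius k \<alpha> G' \<le> (s * (1 - \<epsilon>') * \<pi> - \<kappa>) * real n powr (s - 1)"
        using card' by (intro exI[of _ ?G]) simp
    qed
  qed
  then show ?thesis using that \<kappa> by blast
qed

theorem theorem3p1:
  fixes k :: nat and \<alpha> \<epsilon> \<epsilon>' :: real and \<F> :: "'a::infinite hypergraph set"
  assumes "k \<ge> 2" and "\<alpha> > 1" and "0 < \<epsilon>" and "\<epsilon> < 1"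
    and "\<forall>F\<in>\<F>. kgraph k F"
    and "turan_density k \<F> > 0"
    and "\<epsilon>' = \<epsilon> * turan_density k \<F> * (\<alpha> - 1) / (2 * real k * \<alpha>)"
    and "\<exists>N. \<forall>n\<ge>N.
           max_spectral_radius k \<alpha> (dense_free_graphs k \<F> \<epsilon> n) \<ge>
           max_spectral_radius k \<alpha> (dense_free_graphs k \<F> \<epsilon> (n - 1)) +
           (real k - real k / \<alpha>) * (1 - \<epsilon>') * turan_density k \<F> *
             real n powr (real k - real k / \<alpha> - 1)"
  shows "\<exists>n\<^sub>0. \<forall>n\<ge>n\<^sub>0. \<forall>H :: 'a hypergraph.
           kgraph k H \<and> card (verts H) = n \<and> family_free \<F> H \<longrightarrow>
             spectral_radius k \<alpha> H \<le> max_spectral_radius k \<alpha> (dense_free_graphs k \<F> \<epsilon> n) \<and>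
             (spectral_radius k \<alpha> H = max_spectral_radius k \<alpha> (dense_free_graphs k \<F> \<epsilon> n) \<longrightarrow>
                H \<in> dense_free_graphs k \<F> \<epsilon> n)"
proof -
  define \<pi> where "\<pi> = turan_density k \<F>"
  define s where "s = real k - real k / \<alpha>"
  define D where "D = (\<lambda>n. max_spectral_radius k \<alpha> (dense_free_graphs k \<F> \<epsilon> n))"
  \<comment> \<open>Any \<open>\<eta> > \<epsilon>'\<close> with \<open>(k + 1) \<eta> < \<epsilon> \<pi>\<close> works; \<open>(k + 1) \<epsilon>' \<le> 3/4 \<epsilon> \<pi>\<close> leaves room for \<open>9/8\<close>.\<close>
  define \<eta> where "\<eta> = 9 / 8 * \<epsilon>'"
  have k: "1 \<le> k" using assms by simp
  have \<pi>: "0 < \<pi>" using assms by (simp add: \<pi>_def)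
  have \<pi>1: "\<pi> \<le> 1" unfolding \<pi>_def by (rule turan_density_le_1[OF k]) (use assms in simp)
  have s: "s > 0" using k assms by (simp add: s_def field_simps)
  have \<epsilon>\<pi>: "0 < \<epsilon> * \<pi>" "\<epsilon> * \<pi> < 1" using \<pi> \<pi>1 assms mult_less_le_imp_less[of \<epsilon> 1 \<pi> 1] by auto
  have \<epsilon>'0: "0 < \<epsilon>'" using assms by simp
  have "\<epsilon>' = \<epsilon> * \<pi> / (2 * real k) * ((\<alpha> - 1) / \<alpha>)" using assms by (simp add: \<pi>_def)
  also have "\<dots> \<le> \<epsilon> * \<pi> / (2 * real k) * 1"
    using assms \<epsilon>\<pi> by (intro mult_left_mono) auto
  finally have \<epsilon>'k: "2 * (real k * \<epsilon>') \<le> \<epsilon> * \<pi>" using k by (simp add: field_simps)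
  moreover have "2 * \<epsilon>' \<le> real k * \<epsilon>'" using assms(1) \<epsilon>'0 by simp
  moreover have "(real k + 1) * \<eta> = 9 / 8 * (real k * \<epsilon>') + 9 / 8 * \<epsilon>'"
    by (simp add: \<eta>_def algebra_simps)
  ultimately have \<eta>: "0 \<le> \<epsilon>'" "\<epsilon>' < \<eta>" "\<eta> < 1" "(real k + 1) * \<eta> < \<epsilon> * \<pi>"
    using \<epsilon>'0 \<epsilon>\<pi> unfolding \<eta>_def by linarith+
  obtain N where rec: "\<And>n. n \<ge> N \<Longrightarrow> D (n - 1) + s * ((1 - \<epsilon>') * \<pi>) * real n powr (s - 1) \<le> D n"
    using assms(8) unfolding D_def s_def \<pi>_def by (auto simp: mult.assoc)
  have D_lower: "\<forall>\<^sub>F n in sequentially. (1 - \<eta>) * \<pi> * real n powr s \<le> D n"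
    by (rule recurrence_lower_bound[OF s _ _ rec]) (use \<eta> \<pi> in auto)
  obtain \<kappa> where \<kappa>: "\<kappa> > 0" and del: "\<forall>\<^sub>F n in sequentially. \<forall>G :: 'a hypergraph.
      kgraph k G \<and> card (verts G) = n \<and> family_free \<F> G \<and> G \<notin> dense_free_graphs k \<F> \<epsilon> n \<and>
      (1 - \<eta>) * \<pi> * real n powr s \<le> spectral_radius k \<alpha> G \<longrightarrow>
      (\<exists>G' :: 'a hypergraph. kgraph k G' \<and> card (verts G') = n - 1 \<and> family_free \<F> G' \<and>
        spectral_radius k \<alpha> G - spectral_radius k \<alpha> G' \<le> (s * (1 - \<epsilon>') * \<pi> - \<kappa>) * real n powr (s - 1))"
    using exists_vertex_deletion[of k \<alpha> \<epsilon> \<F> \<epsilon>' \<eta>] k assms(2-4) \<pi> \<eta> unfolding \<pi>_def s_def by blast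
  have "\<forall>\<^sub>F n in sequentially. (1 - \<eta>) * \<pi> * real n powr s \<le> D n \<and> n \<ge> max 1 N \<and> (\<forall>G :: 'a hypergraph.
      kgraph k G \<and> card (verts G) = n \<and> family_free \<F> G \<and> G \<notin> dense_free_graphs k \<F> \<epsilon> n \<and>
      (1 - \<eta>) * \<pi> * real n powr s \<le> spectral_radius k \<alpha> G \<longrightarrow>
      (\<exists>G' :: 'a hypergraph. kgraph k G' \<and> card (verts G') = n - 1 \<and> family_free \<F> G' \<and>
        spectral_radius k \<alpha> G - spectral_radius k \<alpha> G' \<le> (s * (1 - \<epsilon>') * \<pi> - \<kappa>) * real n powr (s - 1)))"
    by (intro eventually_conj D_lower del eventually_ge_at_top)
  then obtain M where M: "\<And>n. n \<ge> M \<Longrightarrow> (1 - \<eta>) * \<pi> * real n powr s \<le> D n"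
      "\<And>n. n \<ge> M \<Longrightarrow> n \<ge> max 1 N"
    and delete: "\<And>n (G :: 'a hypergraph). n \<ge> M \<Longrightarrow> kgraph k G \<Longrightarrow> card (verts G) = n \<Longrightarrow> family_free \<F> G \<Longrightarrow>
      G \<notin> dense_free_graphs k \<F> \<epsilon> n \<Longrightarrow> (1 - \<eta>) * \<pi> * real n powr s \<le> spectral_radius k \<alpha> G \<Longrightarrow>
      (\<exists>G' :: 'a hypergraph. kgraph k G' \<and> card (verts G') = n - 1 \<and> family_free \<F> G' \<and>
        spectral_radius k \<alpha> G - spectral_radius k \<alpha> G' \<le> (s * (1 - \<epsilon>') * \<pi> - \<kappa>) * real n powr (s - 1))"
    unfolding eventually_sequentially by blast
  \<comment> \<open>\<open>D\<close> may be the junk value \<open>Max {}\<close> at some \<open>n\<close>; only the recurrence for \<open>D\<close> is used.\<close>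
  have descent: "\<exists>H' :: 'a hypergraph. kgraph k H' \<and> card (verts H') = M \<and>
      D M + g + \<kappa> * (\<Sum>i\<in>{M<..n}. real i powr (s - 1)) \<le> spectral_radius k \<alpha> H'"
    if "n \<ge> M" "kgraph k H" "card (verts H) = n" "family_free \<F> H"
      "H \<notin> dense_free_graphs k \<F> \<epsilon> n" "0 \<le> g" "D n + g \<le> spectral_radius k \<alpha> H"
    for n g and H :: "'a hypergraph"
    using that
  proof (induction n arbitrary: H g rule: dec_induct)
    case base
    then show ?case by (intro exI[of _ H]) simp
  next
    case (step n)
    let ?m = "Suc n" and ?p = "real (Suc n) powr (s - 1)"
    have m: "?m \<ge> M" "?m \<ge> N" using step.hyps M(2)[of ?m] by auto
    have "(1 - \<eta>) * \<pi> * real ?m powr s \<le> spectral_radius k \<alpha> H"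
      using M(1)[OF m(1)] step.prems by simp
    then obtain G' :: "'a hypergraph" where G': "kgraph k G'" "card (verts G') = n" "family_free \<F> G'"
      "spectral_radius k \<alpha> H - spectral_radius k \<alpha> G' \<le> (s * (1 - \<epsilon>') * \<pi> - \<kappa>) * ?p"
      using delete[OF m(1), of H] step.prems by auto
    have \<kappa>p: "0 < \<kappa> * ?p" using \<kappa> by simp
    have gap: "D n + (g + \<kappa> * ?p) \<le> spectral_radius k \<alpha> G'"
      using rec[OF m(2)] G'(4) step.prems by (simp add: algebra_simps)
    have "G' \<notin> dense_free_graphs k \<F> \<epsilon> n"
      using spectral_radius_le_max[of G' k \<F> \<epsilon> n \<alpha>] gap \<kappa>p step.prems by (auto simp: D_def)
    then obtain H' :: "'a hypergraph" where "kgraph k H'" "card (verts H') = M"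
      "D M + (g + \<kappa> * ?p) + \<kappa> * (\<Sum>i\<in>{M<..n}. real i powr (s - 1)) \<le> spectral_radius k \<alpha> H'"
      using step.IH[OF G'(1-3) _ _ gap] \<kappa>p step.prems by auto
    moreover have "{M<..Suc n} = insert (Suc n) {M<..n}" using step.hyps by auto
    ultimately show ?case by (intro exI[of _ H']) (simp add: algebra_simps)
  qed
  define C where "C = (real M powr s - D M) / \<kappa>"
  have "filterlim (\<lambda>n. real n powr s) at_top sequentially" using s by real_asymp
  then have "\<forall>\<^sub>F n in sequentially. 2 * s * C + 1 \<le> real n powr s"
    unfolding filterlim_at_top by blast
  then have "\<forall>\<^sub>F n in sequentially. C < (\<Sum>i\<in>{M<..n}. real i powr (s - 1)) \<and> M \<le> n"
    using sum_powr_lower_bound[OF s, of "1 / 2" M, simplified] eventually_ge_at_top[of M]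
  proof eventually_elim
    case (elim n)
    have "s * C < s * (\<Sum>i\<in>{M<..n}. real i powr (s - 1))"
      using elim by (simp add: sum_distrib_left)
    then show ?case using elim s by simp
  qed
  then obtain n\<^sub>0 where n0: "\<And>n. n \<ge> n\<^sub>0 \<Longrightarrow> C < (\<Sum>i\<in>{M<..n}. real i powr (s - 1)) \<and> M \<le> n"
    unfolding eventually_sequentially by blast
  have below: "spectral_radius k \<alpha> H < D n"
    if n: "n \<ge> n\<^sub>0" and H: "kgraph k H" "card (verts H) = n" "family_free \<F> H"
      "H \<notin> dense_free_graphs k \<F> \<epsilon> n" for n and H :: "'a hypergraph"
  proof (rule ccontr)
    assume "\<not> spectral_radius k \<alpha> H < D n"
    then obtain H' :: "'a hypergraph" where H': "kgraph k H'" "card (verts H') = M"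
      "D M + 0 + \<kappa> * (\<Sum>i\<in>{M<..n}. real i powr (s - 1)) \<le> spectral_radius k \<alpha> H'"
      using descent[of n H 0] n0[OF n] H by auto
    have "verts H' \<noteq> {}" using M(2)[of M] H' by auto
    then have "spectral_radius k \<alpha> H' \<le> real M powr s"
      using spectral_radius_le[OF H'(1) _ assms(2)] H' by (simp add: s_def)
    then have "(\<Sum>i\<in>{M<..n}. real i powr (s - 1)) \<le> C"
      using H'(3) \<kappa> by (simp add: C_def field_simps)
    then show False using n0[OF n] by simp
  qed
  show ?thesis
  proof (intro exI[of _ n\<^sub>0] allI impI, elim conjE)
    fix n and H :: "'a hypergraph"
    assume "n \<ge> n\<^sub>0" "kgraph k H" "card (verts H) = n" "family_free \<F> H"
    then show "spectral_radius k \<alpha> H \<le> max_spectral_radius k \<alpha> (dense_free_graphs k \<F> \<epsilon> n) \<and>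
             (spectral_radius k \<alpha> H = max_spectral_radius k \<alpha> (dense_free_graphs k \<F> \<epsilon> n) \<longrightarrow>
                H \<in> dense_free_graphs k \<F> \<epsilon> n)"
      using below[of n H] spectral_radius_le_max[of H k \<F> \<epsilon> n \<alpha>] unfolding D_def by fastforce
  qed
qed

end
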